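(* Let $m\ge 2$. The group $\tilde{y}(m)$ is isomorphic to the semidirect product $Y(m):(S_m\times C_2)$, where $S_m$ acts on $Y(m)$ by permuting the generators $a_1,\dots,a_m$ naturally and the generator of the direct factor $C_2$ inverts every $a_i$.
   Context: Conventions: $x^y=y^{-1}xy$, $[x,y]=x^{-1}y^{-1}xy$. $S_m$ is the symmetric group on $\{1,\dots,m\}$ and $s_i=(i,i+1)$ for $1\le i\le m-1$. $Y(m)=\langle a_1,\dots,a_m \mid (a_i^k a_j^k)^2=1 \text{ for all } i\ne j,\ k\in\mathbb{Z}\rangle$. $y(m)=\langle a, S_m \mid [s_1,s_1^{a^k}]=1 \text{ for all } k\in\mathbb{Z},\ a^{s_i}=a^{-1} \text{ for } 2\le i\le m-1\rangle$, i.e. the quotient of the free product of the infinite cyclic group $\langle a\rangle$ and $S_m$ by the listed relations. $\tilde{y}(m)$ is the semidirect product $y(m)\langle\tau\rangle$, where $\tau$ is an involution acting on $y(m)$ as the automorphism that inverts $a$ and centralises $S_m$. $C_2$ is the cyclic group of order 2. *)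

theory Defs
  imports "HOL-Algebra.Sym_Groups" "HOL-Algebra.Elementary_Groups" "HOL-Algebra.Bij"
begin

section \<open>Words modulo a congruence\<close>

text \<open>The least congruence on the free monoid of words over the alphabet \<open>A\<close> containing the
  pairs of \<open>E\<close>, and the quotient monoid.\<close>

inductive_set word_cong :: "'c set \<Rightarrow> ('c list \<times> 'c list) set \<Rightarrow> ('c list \<times> 'c list) set"
  for A E where
  step: "\<lbrakk>(l, r) \<in> E; l \<in> lists A; r \<in> lists A; u \<in> lists A; v \<in> lists A\<rbrakk>
         \<Longrightarrow> (u @ l @ v, u @ r @ v) \<in> word_cong A E"
| refl: "u \<in> lists A \<Longrightarrow> (u, u) \<in> word_cong A E"
| sym: "(u, v) \<in> word_cong A E \<Longrightarrow> (v, u) \<in> word_cong A E"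
| trans: "\<lbrakk>(u, v) \<in> word_cong A E; (v, w) \<in> word_cong A E\<rbrakk> \<Longrightarrow> (u, w) \<in> word_cong A E"

definition word_monoid :: "'c set \<Rightarrow> ('c list \<times> 'c list) set \<Rightarrow> 'c list set monoid" where
  "word_monoid A E =
    \<lparr>carrier = lists A // word_cong A E,
     monoid.mult = (\<lambda>U V. \<Union>u\<in>U. \<Union>v\<in>V. word_cong A E `` {u @ v}),
     one = word_cong A E `` {[]}\<rparr>"

section \<open>Free groups, free products, presentations\<close>

text \<open>A presented group is \<open>F Mod normal_closure F R\<close>, where \<open>F\<close> is a free group or a free product.
  In \<open>free_group\<close> the letter \<open>(x, True)\<close> stands for the generator \<open>x\<close>, and \<open>(x, False)\<close> for its inverse.\<close>

definition free_group_rules :: "'a set \<Rightarrow> (('a \<times> bool) list \<times> ('a \<times> bool) list) set" where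
  "free_group_rules X = {([(x, b), (x, \<not> b)], []) | x b. x \<in> X}"

definition free_group :: "'a set \<Rightarrow> ('a \<times> bool) list set monoid" where
  "free_group X = word_monoid (X \<times> UNIV) (free_group_rules X)"

definition free_gen :: "'a set \<Rightarrow> 'a \<Rightarrow> ('a \<times> bool) list set" where
  "free_gen X x = word_cong (X \<times> UNIV) (free_group_rules X) `` {[(x, True)]}"

definition free_product_rules ::
  "('a, 'c) monoid_scheme \<Rightarrow> ('b, 'd) monoid_scheme \<Rightarrow> (('a + 'b) list \<times> ('a + 'b) list) set" where
  "free_product_rules G H =
     {([Inl x, Inl y], [Inl (x \<otimes>\<^bsub>G\<^esub> y)]) | x y. x \<in> carrier G \<and> y \<in> carrier G} \<union>
     {([Inr x, Inr y], [Inr (x \<otimes>\<^bsub>H\<^esub> y)]) | x y. x \<in> carrier H \<and> y \<in> carrier H} \<union>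
     {([Inl \<one>\<^bsub>G\<^esub>], []), ([Inr \<one>\<^bsub>H\<^esub>], [])}"

definition free_product ::
  "('a, 'c) monoid_scheme \<Rightarrow> ('b, 'd) monoid_scheme \<Rightarrow> ('a + 'b) list set monoid" where
  "free_product G H = word_monoid (carrier G <+> carrier H) (free_product_rules G H)"

definition free_product_inl ::
  "('a, 'c) monoid_scheme \<Rightarrow> ('b, 'd) monoid_scheme \<Rightarrow> 'a \<Rightarrow> ('a + 'b) list set" where
  "free_product_inl G H x = word_cong (carrier G <+> carrier H) (free_product_rules G H) `` {[Inl x]}"

definition free_product_inr ::
  "('a, 'c) monoid_scheme \<Rightarrow> ('b, 'd) monoid_scheme \<Rightarrow> 'b \<Rightarrow> ('a + 'b) list set" where
  "free_product_inr G H y = word_cong (carrier G <+> carrier H) (free_product_rules G H) `` {[Inr y]}"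

definition normal_closure :: "('a, 'b) monoid_scheme \<Rightarrow> 'a set \<Rightarrow> 'a set" where
  "normal_closure G R = \<Inter>{N. N \<lhd> G \<and> R \<subseteq> N}"

definition group_conj :: "('a, 'b) monoid_scheme \<Rightarrow> 'a \<Rightarrow> 'a \<Rightarrow> 'a" where
  "group_conj G x y = inv\<^bsub>G\<^esub> y \<otimes>\<^bsub>G\<^esub> x \<otimes>\<^bsub>G\<^esub> y"

definition group_comm :: "('a, 'b) monoid_scheme \<Rightarrow> 'a \<Rightarrow> 'a \<Rightarrow> 'a" where
  "group_comm G x y = inv\<^bsub>G\<^esub> x \<otimes>\<^bsub>G\<^esub> inv\<^bsub>G\<^esub> y \<otimes>\<^bsub>G\<^esub> x \<otimes>\<^bsub>G\<^esub> y"

section \<open>Semidirect products\<close>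

text \<open>\<open>\<phi>\<close> is meant to be a homomorphism from \<open>H\<close> to \<open>AutoGroup N\<close>, so \<open>H\<close> acts on the left:
  with \<open>N\<close> and \<open>H\<close> embedded as usual, \<open>h n h\<^sup>-\<^sup>1 = \<phi> h n\<close>.\<close>

definition semidirect_product ::
  "('a, 'c) monoid_scheme \<Rightarrow> ('b, 'd) monoid_scheme \<Rightarrow> ('b \<Rightarrow> 'a \<Rightarrow> 'a) \<Rightarrow> ('a \<times> 'b) monoid" where
  "semidirect_product N H \<phi> =
    \<lparr>carrier = carrier N \<times> carrier H,
     monoid.mult = (\<lambda>(n, h) (n', h'). (n \<otimes>\<^bsub>N\<^esub> \<phi> h n', h \<otimes>\<^bsub>H\<^esub> h')),
     one = (\<one>\<^bsub>N\<^esub>, \<one>\<^bsub>H\<^esub>)\<rparr>"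

section \<open>The group \<open>Y(m)\<close> and the action of \<open>S\<^sub>m \<times> C\<^sub>2\<close>\<close>

definition Y_relators :: "nat \<Rightarrow> (nat \<times> bool) list set set" where
  "Y_relators m =
    (let F = free_group {1..m}; a = free_gen {1..m} in
     {(a i [^]\<^bsub>F\<^esub> k \<otimes>\<^bsub>F\<^esub> a j [^]\<^bsub>F\<^esub> k) [^]\<^bsub>F\<^esub> (2::nat) | i j (k::int).
        i \<in> {1..m} \<and> j \<in> {1..m} \<and> i \<noteq> j})"

definition Y_group :: "nat \<Rightarrow> (nat \<times> bool) list set set monoid" where
  "Y_group m = free_group {1..m} Mod normal_closure (free_group {1..m}) (Y_relators m)"

definition Y_gen :: "nat \<Rightarrow> nat \<Rightarrow> (nat \<times> bool) list set set" where
  "Y_gen m i =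
     normal_closure (free_group {1..m}) (Y_relators m) #>\<^bsub>free_group {1..m}\<^esub> free_gen {1..m} i"

text \<open>The group \<open>C\<^sub>2\<close> is \<open>integer_mod_group 2\<close>, with elements \<open>0\<close> and \<open>1\<close>. \<open>S\<^sub>m\<close> acts
  on the left, by \<open>\<sigma> a\<^sub>i = a\<^bsub>\<sigma> i\<^esub>\<close>; for permutations acting on the right, replace \<open>\<sigma>\<close> by its
  inverse.\<close>

definition Y_action ::
  "nat \<Rightarrow> (nat \<Rightarrow> nat) \<times> int \<Rightarrow> (nat \<times> bool) list set set \<Rightarrow> (nat \<times> bool) list set set" where
  "Y_action m = (\<lambda>(\<sigma>, c). THE f. f \<in> auto (Y_group m) \<and>
     (\<forall>i\<in>{1..m}. f (Y_gen m i) =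
        (if c = 0 then Y_gen m (\<sigma> i) else inv\<^bsub>Y_group m\<^esub> (Y_gen m (\<sigma> i)))))"

section \<open>The group \<open>y(m)\<close> and its extension by \<open>\<tau>\<close>\<close>

text \<open>\<open>sym_group m\<close> multiplies permutations right to left. This does not affect \<open>y(m)\<close>: inversion
  in \<open>S\<^sub>m\<close> is an isomorphism to the group with the opposite multiplication, and it fixes every
  \<open>s\<^sub>i\<close>.\<close>

abbreviation y_free :: "nat \<Rightarrow> (int + (nat \<Rightarrow> nat)) list set monoid" where
  "y_free m \<equiv> free_product integer_group (sym_group m)"

abbreviation y_inl :: "nat \<Rightarrow> int \<Rightarrow> (int + (nat \<Rightarrow> nat)) list set" where
  "y_inl m \<equiv> free_product_inl integer_group (sym_group m)"

abbreviation y_inr :: "nat \<Rightarrow> (nat \<Rightarrow> nat) \<Rightarrow> (int + (nat \<Rightarrow> nat)) list set" where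
  "y_inr m \<equiv> free_product_inr integer_group (sym_group m)"

definition y_relators :: "nat \<Rightarrow> (int + (nat \<Rightarrow> nat)) list set set" where
  "y_relators m =
    (let F = y_free m;
         a = y_inl m 1;
         s = (\<lambda>i. y_inr m (transpose i (i + 1)))
     in \<comment> \<open>the second kind is the relation \<open>a\<^sup>s = a\<^sup>-\<^sup>1\<close>\<close>
        {group_comm F (s 1) (group_conj F (s 1) (a [^]\<^bsub>F\<^esub> k)) | k :: int. True} \<union>
        {group_conj F a (s i) \<otimes>\<^bsub>F\<^esub> a | i. 2 \<le> i \<and> i \<le> m - 1})"

definition y_group :: "nat \<Rightarrow> (int + (nat \<Rightarrow> nat)) list set set monoid" where
  "y_group m = y_free m Mod normal_closure (y_free m) (y_relators m)"

definition y_gen :: "nat \<Rightarrow> (int + (nat \<Rightarrow> nat)) list set set" where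
  "y_gen m = normal_closure (y_free m) (y_relators m) #>\<^bsub>y_free m\<^esub> y_inl m 1"

definition y_perm :: "nat \<Rightarrow> (nat \<Rightarrow> nat) \<Rightarrow> (int + (nat \<Rightarrow> nat)) list set set" where
  "y_perm m \<sigma> = normal_closure (y_free m) (y_relators m) #>\<^bsub>y_free m\<^esub> y_inr m \<sigma>"

definition tau_auto ::
  "nat \<Rightarrow> (int + (nat \<Rightarrow> nat)) list set set \<Rightarrow> (int + (nat \<Rightarrow> nat)) list set set" where
  "tau_auto m = (THE f. f \<in> auto (y_group m) \<and> f (y_gen m) = inv\<^bsub>y_group m\<^esub> (y_gen m) \<and>
     (\<forall>\<sigma>\<in>carrier (sym_group m). f (y_perm m \<sigma>) = y_perm m \<sigma>))"

definition tau_action ::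
  "nat \<Rightarrow> int \<Rightarrow> (int + (nat \<Rightarrow> nat)) list set set \<Rightarrow> (int + (nat \<Rightarrow> nat)) list set set" where
  "tau_action m c = (if c = 0 then \<one>\<^bsub>AutoGroup (y_group m)\<^esub> else tau_auto m)"

definition ytilde_group ::
  "nat \<Rightarrow> ((int + (nat \<Rightarrow> nat)) list set set \<times> int) monoid" where
  "ytilde_group m = semidirect_product (y_group m) (integer_mod_group 2) (tau_action m)"

section \<open>Well-definedness\<close>

text \<open>The structures above are groups, and both descriptions by \<open>THE\<close> determine an
  automorphism.\<close>

subsection \<open>Words modulo a congruence\<close>

declare in_listsI [rule del] in_listsD [rule del]

lemma word_cong_lists: "(u, v) \<in> word_cong A E \<Longrightarrow> u \<in> lists A \<and> v \<in> lists A"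
  by (induction rule: word_cong.induct) auto

lemma equiv_word_cong: "equiv (lists A) (word_cong A E)"
  unfolding equiv_def refl_on_def sym_on_def trans_on_def
  by (auto dest: word_cong_lists intro: word_cong.refl word_cong.sym word_cong.trans)

lemma word_cong_append_left:
  "(u, v) \<in> word_cong A E \<Longrightarrow> w \<in> lists A \<Longrightarrow> (w @ u, w @ v) \<in> word_cong A E"
proof (induction rule: word_cong.induct)
  case (step l r u v)
  then show ?case using word_cong.step[of l r E A "w @ u" v] by auto
qed (auto intro: word_cong.refl word_cong.sym word_cong.trans)

lemma word_cong_append_right:
  "(u, v) \<in> word_cong A E \<Longrightarrow> w \<in> lists A \<Longrightarrow> (u @ w, v @ w) \<in> word_cong A E"
proof (induction rule: word_cong.induct)
  case (step l r u v)
  then show ?case using word_cong.step[of l r E A u "v @ w"] by auto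
qed (auto intro: word_cong.refl word_cong.sym word_cong.trans)

lemma word_cong_append:
  assumes "(u, u') \<in> word_cong A E" "(v, v') \<in> word_cong A E"
  shows "(u @ v, u' @ v') \<in> word_cong A E"
  using assms
  by (meson word_cong.trans word_cong_append_left word_cong_append_right word_cong_lists)

lemma word_class_eq_iff:
  assumes "u \<in> lists A" "v \<in> lists A"
  shows "word_cong A E `` {u} = word_cong A E `` {v} \<longleftrightarrow> (u, v) \<in> word_cong A E"
  using equiv_class_eq_iff[OF equiv_word_cong] assms by auto

lemma word_monoid_mult:
  assumes "u \<in> lists A" "v \<in> lists A"
  shows "word_cong A E `` {u} \<otimes>\<^bsub>word_monoid A E\<^esub> word_cong A E `` {v} = word_cong A E `` {u @ v}"
proof -
  have "word_cong A E `` {u' @ v'} = word_cong A E `` {u @ v}"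
    if "(u, u') \<in> word_cong A E" "(v, v') \<in> word_cong A E" for u' v'
    using that by (metis equiv_class_eq equiv_word_cong word_cong_append)
  then show ?thesis
    using assms by (auto simp: word_monoid_def intro: word_cong.refl)
qed

lemma word_monoid_carrierE:
  assumes "U \<in> carrier (word_monoid A E)"
  obtains u where "u \<in> lists A" "U = word_cong A E `` {u}"
  using assms by (auto simp: word_monoid_def quotient_def)

lemma word_monoid_classI: "u \<in> lists A \<Longrightarrow> word_cong A E `` {u} \<in> carrier (word_monoid A E)"
  by (auto simp: word_monoid_def quotient_def)

lemma word_monoid_one: "\<one>\<^bsub>word_monoid A E\<^esub> = word_cong A E `` {[]}"
  by (simp add: word_monoid_def)

lemma group_word_monoid:
  assumes "\<And>x. x \<in> A \<Longrightarrow> \<exists>y\<in>A. (([y, x], []) \<in> word_cong A E)"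
  shows "group (word_monoid A E)"
proof (rule groupI)
  fix x assume "x \<in> carrier (word_monoid A E)"
  then obtain u where u: "u \<in> lists A" "x = word_cong A E `` {u}" by (rule word_monoid_carrierE)
  from u(1) have "\<exists>v\<in>lists A. (v @ u, []) \<in> word_cong A E"
  proof (induction u)
    case Nil
    show ?case by (rule bexI[of _ "[]"]) (auto intro: word_cong.refl)
  next
    case (Cons a u)
    then obtain v where v: "v \<in> lists A" "(v @ u, []) \<in> word_cong A E" by auto
    from assms[of a] Cons obtain b where b: "b \<in> A" "([b, a], []) \<in> word_cong A E" by auto
    have "([b, a] @ u, [] @ u) \<in> word_cong A E"
      using word_cong_append_right[OF b(2), of u] Cons by auto
    then have "(v @ [b, a] @ u, v @ [] @ u) \<in> word_cong A E"
      using word_cong_append_left v(1) by blast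
    then have "((v @ [b]) @ a # u, []) \<in> word_cong A E"
      using word_cong.trans[OF _ v(2)] by auto
    then show ?case using v b by (intro bexI[of _ "v @ [b]"]) auto
  qed
  then obtain v where v: "v \<in> lists A" "(v @ u, []) \<in> word_cong A E" by auto
  show "\<exists>y\<in>carrier (word_monoid A E). y \<otimes>\<^bsub>word_monoid A E\<^esub> x = \<one>\<^bsub>word_monoid A E\<^esub>"
    using u v
    by (intro bexI[of _ "word_cong A E `` {v}"])
      (auto simp: word_monoid_mult word_monoid_one word_class_eq_iff word_monoid_classI)
qed (auto simp: word_monoid_mult word_monoid_one elim!: word_monoid_carrierE intro!: word_monoid_classI)

fun word_eval :: "('b, 'd) monoid_scheme \<Rightarrow> ('c \<Rightarrow> 'b) \<Rightarrow> 'c list \<Rightarrow> 'b" where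
  "word_eval G f [] = \<one>\<^bsub>G\<^esub>"
| "word_eval G f (x # xs) = f x \<otimes>\<^bsub>G\<^esub> word_eval G f xs"

lemma (in monoid) word_eval_closed:
  "f \<in> A \<rightarrow> carrier G \<Longrightarrow> u \<in> lists A \<Longrightarrow> word_eval G f u \<in> carrier G"
  by (induction u) auto

lemma (in monoid) word_eval_append:
  "f \<in> A \<rightarrow> carrier G \<Longrightarrow> u \<in> lists A \<Longrightarrow> v \<in> lists A \<Longrightarrow>
    word_eval G f (u @ v) = word_eval G f u \<otimes> word_eval G f v"
  by (induction u) (auto simp: word_eval_closed m_assoc Pi_iff)

lemma (in monoid) word_eval_cong:
  assumes f: "f \<in> A \<rightarrow> carrier G"
    and E: "\<And>l r. (l, r) \<in> E \<Longrightarrow> word_eval G f l = word_eval G f r"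
  shows "(u, v) \<in> word_cong A E \<Longrightarrow> word_eval G f u = word_eval G f v"
proof (induction rule: word_cong.induct)
  case (step l r u v)
  then show ?case using E[of l r] by (simp add: word_eval_append[OF f])
qed auto

lemma (in monoid) word_monoid_universal:
  assumes f: "f \<in> A \<rightarrow> carrier G"
    and E: "\<And>l r. (l, r) \<in> E \<Longrightarrow> word_eval G f l = word_eval G f r"
  obtains h where "h \<in> hom (word_monoid A E) G" "\<And>x. x \<in> A \<Longrightarrow> h (word_cong A E `` {[x]}) = f x"
proof
  define h where "h U = word_eval G f (SOME u. u \<in> U)" for U
  have h: "h (word_cong A E `` {u}) = word_eval G f u" if "u \<in> lists A" for u
  proof -
    have "(SOME v. v \<in> word_cong A E `` {u}) \<in> word_cong A E `` {u}"
      using that word_cong.refl by (metis Image_singleton_iff someI_ex)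
    then show ?thesis
      using word_eval_cong[OF f E] by (auto simp: h_def)
  qed
  show "h \<in> hom (word_monoid A E) G"
    by (rule homI)
      (auto elim!: word_monoid_carrierE simp: h word_monoid_mult word_eval_append[OF f] word_eval_closed[OF f])
  show "h (word_cong A E `` {[x]}) = f x" if "x \<in> A" for x
    using that f h[of "[x]"] by (auto simp: Pi_iff)
qed

lemma word_monoid_hom_eqI:
  assumes "group (word_monoid A E)" "group K"
    and h: "h \<in> hom (word_monoid A E) K" and k: "k \<in> hom (word_monoid A E) K"
    and eq: "\<And>x. x \<in> A \<Longrightarrow> h (word_cong A E `` {[x]}) = k (word_cong A E `` {[x]})"
    and U: "U \<in> carrier (word_monoid A E)"
  shows "h U = k U"
proof -
  obtain u where u: "u \<in> lists A" "U = word_cong A E `` {u}" using U by (rule word_monoid_carrierE)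
  from u(1) have "h (word_cong A E `` {u}) = k (word_cong A E `` {u})"
  proof (induction u)
    case Nil
    then show ?case
      using hom_one[OF h assms(1,2)] hom_one[OF k assms(1,2)] by (simp add: word_monoid_one)
  next
    case (Cons x u)
    then have "word_cong A E `` {x # u} =
        word_cong A E `` {[x]} \<otimes>\<^bsub>word_monoid A E\<^esub> word_cong A E `` {u}"
      by (subst word_monoid_mult) auto
    with Cons show ?case
      using hom_mult[OF h] hom_mult[OF k] eq[of x] by (simp add: word_monoid_classI)
  qed
  then show ?thesis using u by simp
qed

lemma word_cong_rule:
  "(l, r) \<in> E \<Longrightarrow> l \<in> lists A \<Longrightarrow> r \<in> lists A \<Longrightarrow> (l, r) \<in> word_cong A E"
  using word_cong.step[of l r E A "[]" "[]"] by simp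

subsection \<open>Free groups and free products\<close>

lemma group_free_group: "group (free_group X)"
  unfolding free_group_def
proof (rule group_word_monoid)
  fix x :: "'a \<times> bool" assume x: "x \<in> X \<times> UNIV"
  then have "([(fst x, \<not> snd x), x], []) \<in> word_cong (X \<times> UNIV) (free_group_rules X)"
    by (cases x) (intro word_cong_rule, auto simp: free_group_rules_def)
  then show "\<exists>y\<in>X \<times> UNIV. ([y, x], []) \<in> word_cong (X \<times> UNIV) (free_group_rules X)"
    using x by (intro bexI[of _ "(fst x, \<not> snd x)"]) auto
qed

lemma free_gen_closed: "x \<in> X \<Longrightarrow> free_gen X x \<in> carrier (free_group X)"
  by (simp add: free_gen_def free_group_def word_monoid_classI)

lemma free_group_letter_inv:
  assumes "x \<in> X"
  shows "word_cong (X \<times> UNIV) (free_group_rules X) `` {[(x, False)]} = inv\<^bsub>free_group X\<^esub> (free_gen X x)"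
    (is "?w = _")
proof -
  interpret group "free_group X" by (rule group_free_group)
  have "([(x, False), (x, True)], []) \<in> word_cong (X \<times> UNIV) (free_group_rules X)"
    using assms by (intro word_cong_rule) (auto simp: free_group_rules_def)
  then have "?w \<otimes>\<^bsub>free_group X\<^esub> free_gen X x = \<one>\<^bsub>free_group X\<^esub>"
    using assms by (simp add: free_group_def free_gen_def word_monoid_mult word_monoid_one word_class_eq_iff)
  moreover have "?w \<in> carrier (free_group X)"
    using assms by (auto simp: free_group_def intro!: word_monoid_classI)
  ultimately show ?thesis
    using inv_equality assms free_gen_closed by metis
qed

lemma (in group) free_group_universal:
  assumes f: "f \<in> X \<rightarrow> carrier G"
  obtains h where "h \<in> hom (free_group X) G" "\<And>x. x \<in> X \<Longrightarrow> h (free_gen X x) = f x"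
proof -
  define f' where "f' = (\<lambda>(x, b). if b then f x else inv (f x))"
  have f': "f' \<in> X \<times> UNIV \<rightarrow> carrier G" using f by (auto simp: f'_def Pi_iff)
  have E: "word_eval G f' l = word_eval G f' r" if "(l, r) \<in> free_group_rules X" for l r
    using that f by (auto simp: free_group_rules_def f'_def Pi_iff)
  obtain h where "h \<in> hom (word_monoid (X \<times> UNIV) (free_group_rules X)) G"
    "\<And>x. x \<in> X \<times> UNIV \<Longrightarrow> h (word_cong (X \<times> UNIV) (free_group_rules X) `` {[x]}) = f' x"
    by (rule word_monoid_universal[OF f' E]) auto
  then show ?thesis
    using that[of h] by (auto simp: free_group_def free_gen_def f'_def)
qed

lemma free_group_hom_eqI:
  fixes X :: "'a set"
  assumes "group K" and h: "h \<in> hom (free_group X) K" and k: "k \<in> hom (free_group X) K"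
    and eq: "\<And>x. x \<in> X \<Longrightarrow> h (free_gen X x) = k (free_gen X x)"
    and U: "U \<in> carrier (free_group X)"
  shows "h U = k U"
proof (rule word_monoid_hom_eqI[OF group_free_group[unfolded free_group_def] assms(1)
      h[unfolded free_group_def] k[unfolded free_group_def] _ U[unfolded free_group_def]])
  fix p :: "'a \<times> bool" assume "p \<in> X \<times> UNIV"
  then obtain x b where p: "p = (x, b)" and x: "x \<in> X" by auto
  interpret h: group_hom "free_group X" K h
    by (intro group_hom.intro group_hom_axioms.intro group_free_group assms)
  interpret k: group_hom "free_group X" K k
    by (intro group_hom.intro group_hom_axioms.intro group_free_group assms)
  show "h (word_cong (X \<times> UNIV) (free_group_rules X) `` {[p]}) =
        k (word_cong (X \<times> UNIV) (free_group_rules X) `` {[p]})"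
  proof (cases b)
    case True
    then show ?thesis using eq[OF x] p by (simp add: free_gen_def)
  next
    case False
    then show ?thesis
      using eq[OF x] p x by (simp add: free_group_letter_inv free_gen_closed)
  qed
qed

lemma free_product_inl_hom: "group G \<Longrightarrow> free_product_inl G H \<in> hom G (free_product G H)"
proof (rule homI)
  let ?A = "carrier G <+> carrier H" and ?E = "free_product_rules G H"
  assume "group G"
  then interpret group G .
  show "free_product_inl G H x \<in> carrier (free_product G H)" if "x \<in> carrier G" for x
    using that by (auto simp: free_product_def free_product_inl_def intro!: word_monoid_classI)
  show "free_product_inl G H (x \<otimes>\<^bsub>G\<^esub> y) =
      free_product_inl G H x \<otimes>\<^bsub>free_product G H\<^esub> free_product_inl G H y"
    if xy: "x \<in> carrier G" "y \<in> carrier G" for x y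
  proof -
    have "([Inl x, Inl y], [Inl (x \<otimes>\<^bsub>G\<^esub> y)]) \<in> word_cong ?A ?E"
      by (rule word_cong_rule) (use xy in \<open>auto simp: free_product_rules_def\<close>)
    from equiv_class_eq[OF equiv_word_cong this] show ?thesis
      using xy unfolding free_product_def free_product_inl_def by (subst word_monoid_mult) auto
  qed
qed

lemma free_product_inr_hom: "group H \<Longrightarrow> free_product_inr G H \<in> hom H (free_product G H)"
proof (rule homI)
  let ?A = "carrier G <+> carrier H" and ?E = "free_product_rules G H"
  assume "group H"
  then interpret group H .
  show "free_product_inr G H x \<in> carrier (free_product G H)" if "x \<in> carrier H" for x
    using that by (auto simp: free_product_def free_product_inr_def intro!: word_monoid_classI)
  show "free_product_inr G H (x \<otimes>\<^bsub>H\<^esub> y) =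
      free_product_inr G H x \<otimes>\<^bsub>free_product G H\<^esub> free_product_inr G H y"
    if xy: "x \<in> carrier H" "y \<in> carrier H" for x y
  proof -
    have "([Inr x, Inr y], [Inr (x \<otimes>\<^bsub>H\<^esub> y)]) \<in> word_cong ?A ?E"
      by (rule word_cong_rule) (use xy in \<open>auto simp: free_product_rules_def\<close>)
    from equiv_class_eq[OF equiv_word_cong this] show ?thesis
      using xy unfolding free_product_def free_product_inr_def by (subst word_monoid_mult) auto
  qed
qed

lemma group_free_product:
  assumes "group G" "group H"
  shows "group (free_product G H)"
  unfolding free_product_def
proof (rule group_word_monoid)
  interpret G: group G by fact
  interpret H: group H by fact
  let ?A = "carrier G <+> carrier H" and ?E = "free_product_rules G H"
  fix x assume "x \<in> ?A"
  then show "\<exists>y\<in>?A. ([y, x], []) \<in> word_cong ?A ?E"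
  proof
    fix g assume x: "x = Inl g" "g \<in> carrier G"
    have "([Inl (inv\<^bsub>G\<^esub> g), Inl g], [Inl \<one>\<^bsub>G\<^esub>]) \<in> word_cong ?A ?E"
      using x G.l_inv[of g, symmetric] by (intro word_cong_rule) (auto simp: free_product_rules_def simp del: G.l_inv)
    moreover have "([Inl \<one>\<^bsub>G\<^esub>], []) \<in> word_cong ?A ?E"
      by (intro word_cong_rule) (auto simp: free_product_rules_def)
    ultimately show ?thesis
      using x by (intro bexI[of _ "Inl (inv\<^bsub>G\<^esub> g)"]) (auto intro: word_cong.trans)
  next
    fix g assume x: "x = Inr g" "g \<in> carrier H"
    have "([Inr (inv\<^bsub>H\<^esub> g), Inr g], [Inr \<one>\<^bsub>H\<^esub>]) \<in> word_cong ?A ?E"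
      using x H.l_inv[of g, symmetric] by (intro word_cong_rule) (auto simp: free_product_rules_def simp del: H.l_inv)
    moreover have "([Inr \<one>\<^bsub>H\<^esub>], []) \<in> word_cong ?A ?E"
      by (intro word_cong_rule) (auto simp: free_product_rules_def)
    ultimately show ?thesis
      using x by (intro bexI[of _ "Inr (inv\<^bsub>H\<^esub> g)"]) (auto intro: word_cong.trans)
  qed
qed

lemma (in group) free_product_universal:
  assumes "group G1" "group G2" and p: "p \<in> hom G1 G" and q: "q \<in> hom G2 G"
  obtains h where "h \<in> hom (free_product G1 G2) G"
    "\<And>x. x \<in> carrier G1 \<Longrightarrow> h (free_product_inl G1 G2 x) = p x"
    "\<And>y. y \<in> carrier G2 \<Longrightarrow> h (free_product_inr G1 G2 y) = q y"
proof -
  let ?A = "carrier G1 <+> carrier G2" and ?E = "free_product_rules G1 G2"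
  define f where "f = case_sum p q"
  have f: "f \<in> ?A \<rightarrow> carrier G"
    using hom_in_carrier[OF p] hom_in_carrier[OF q] by (auto simp: f_def)
  have E: "word_eval G f l = word_eval G f r" if "(l, r) \<in> ?E" for l r
    using that hom_in_carrier[OF p] hom_in_carrier[OF q] hom_mult[OF p] hom_mult[OF q]
      hom_one[OF p assms(1) is_group] hom_one[OF q assms(2) is_group]
      group.is_monoid[OF assms(1)] group.is_monoid[OF assms(2)]
    by (auto simp: free_product_rules_def f_def monoid.m_closed)
  obtain h where "h \<in> hom (word_monoid ?A ?E) G" "\<And>x. x \<in> ?A \<Longrightarrow> h (word_cong ?A ?E `` {[x]}) = f x"
    by (rule word_monoid_universal[OF f E]) auto
  then show ?thesis
    by (intro that[of h]) (simp_all add: free_product_def free_product_inl_def free_product_inr_def f_def InlI InrI)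
qed

lemma free_product_hom_eqI:
  assumes "group G" "group H" "group K"
    and h: "h \<in> hom (free_product G H) K" and k: "k \<in> hom (free_product G H) K"
    and "\<And>x. x \<in> carrier G \<Longrightarrow> h (free_product_inl G H x) = k (free_product_inl G H x)"
    and "\<And>y. y \<in> carrier H \<Longrightarrow> h (free_product_inr G H y) = k (free_product_inr G H y)"
    and U: "U \<in> carrier (free_product G H)"
  shows "h U = k U"
  by (rule word_monoid_hom_eqI[OF group_free_product[OF assms(1,2), unfolded free_product_def] assms(3)
      h[unfolded free_product_def] k[unfolded free_product_def] _ U[unfolded free_product_def]])
    (use assms(6,7) in \<open>auto simp: free_product_inl_def free_product_inr_def\<close>)

declare in_listsI [intro!] in_listsD [dest!]

subsection \<open>Presented groups\<close>

lemma (in group) normal_closure_normal: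
  assumes "R \<subseteq> carrier G"
  shows "normal_closure G R \<lhd> G"
proof (rule normal_invI)
  have top: "carrier G \<lhd> G" by (rule normal_invI) (auto simp: subgroup_self)
  show "subgroup (normal_closure G R) G"
    unfolding normal_closure_def
    by (rule subgroups_Inter) (use assms top in \<open>auto simp: normal_imp_subgroup\<close>)
  show "x \<otimes> h \<otimes> inv x \<in> normal_closure G R" if "x \<in> carrier G" "h \<in> normal_closure G R" for x h
    using that by (auto simp: normal_closure_def intro: normal.inv_op_closed2)
qed

lemma (in group) normal_closure_superset: "R \<subseteq> normal_closure G R"
  by (auto simp: normal_closure_def)

lemma (in group) presented_universal:
  assumes "R \<subseteq> carrier G" "group K" "h \<in> hom G K" "\<And>r. r \<in> R \<Longrightarrow> h r = \<one>\<^bsub>K\<^esub>"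
  obtains g where "g \<in> hom (G Mod normal_closure G R) K"
    "\<And>x. x \<in> carrier G \<Longrightarrow> g (normal_closure G R #> x) = h x"
proof -
  interpret h: group_hom G K h
    by (intro group_hom.intro group_hom_axioms.intro is_group assms)
  have "normal_closure G R \<subseteq> kernel G K h"
    unfolding normal_closure_def
    by (rule Inter_lower) (use assms h.normal_kernel in \<open>auto simp: kernel_def\<close>)
  from h.FactGroup_universal_kernel[OF normal_closure_normal[OF assms(1)] this] that
  show thesis by blast
qed

lemma (in group) presented_hom_eqI:
  assumes R: "R \<subseteq> carrier G" and h: "h \<in> hom (G Mod normal_closure G R) K"
    and k: "k \<in> hom (G Mod normal_closure G R) K"
    and eq: "\<And>h k x. h \<in> hom G K \<Longrightarrow> k \<in> hom G K \<Longrightarrow> x \<in> carrier G \<Longrightarrow> P h k \<Longrightarrow> h x = k x"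
    and P: "P (\<lambda>x. h (normal_closure G R #> x)) (\<lambda>x. k (normal_closure G R #> x))"
    and U: "U \<in> carrier (G Mod normal_closure G R)"
  shows "h U = k U"
proof -
  interpret N: normal "normal_closure G R" G by (rule normal_closure_normal[OF R])
  obtain x where x: "x \<in> carrier G" "U = normal_closure G R #> x"
    using U by (auto simp: carrier_FactGroup)
  have "(\<lambda>x. h (normal_closure G R #> x)) \<in> hom G K" "(\<lambda>x. k (normal_closure G R #> x)) \<in> hom G K"
    using Group.hom_compose[OF N.r_coset_hom_Mod h] Group.hom_compose[OF N.r_coset_hom_Mod k]
    by (simp_all add: o_def)
  from eq[OF this x(1) P] show ?thesis using x by simp
qed

subsection \<open>Semidirect products\<close>

lemma hom_AutoGroupI:
  assumes N: "group N" and H: "group H"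
    and hom: "\<And>h. h \<in> carrier H \<Longrightarrow> \<Phi> h \<in> hom N N"
    and one: "\<And>n. n \<in> carrier N \<Longrightarrow> \<Phi> \<one>\<^bsub>H\<^esub> n = n"
    and mult: "\<And>h k n. h \<in> carrier H \<Longrightarrow> k \<in> carrier H \<Longrightarrow> n \<in> carrier N \<Longrightarrow>
      \<Phi> (h \<otimes>\<^bsub>H\<^esub> k) n = \<Phi> h (\<Phi> k n)"
  shows "(\<lambda>h. restrict (\<Phi> h) (carrier N)) \<in> hom H (AutoGroup N)"
proof -
  interpret H: group H by fact
  interpret N: group N by fact
  have auto: "restrict (\<Phi> h) (carrier N) \<in> auto N" if h: "h \<in> carrier H" for h
  proof -
    have "bij_betw (\<Phi> h) (carrier N) (carrier N)"
    proof (rule bij_betwI[where g = "\<Phi> (inv\<^bsub>H\<^esub> h)"])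
      show "\<Phi> h \<in> carrier N \<rightarrow> carrier N" "\<Phi> (inv\<^bsub>H\<^esub> h) \<in> carrier N \<rightarrow> carrier N"
        using h hom by (auto simp: hom_def)
      show "\<Phi> (inv\<^bsub>H\<^esub> h) (\<Phi> h x) = x" "\<Phi> h (\<Phi> (inv\<^bsub>H\<^esub> h) x) = x" if "x \<in> carrier N" for x
        using h that mult[of h "inv\<^bsub>H\<^esub> h" x] mult[of "inv\<^bsub>H\<^esub> h" h x] one by simp_all
    qed
    moreover have "restrict (\<Phi> h) (carrier N) \<in> hom N N"
      using hom[OF h] by (auto simp: hom_def)
    ultimately show ?thesis by (simp add: auto_def Bij_def)
  qed
  have "restrict (\<Phi> (h \<otimes>\<^bsub>H\<^esub> k)) (carrier N) =
      compose (carrier N) (restrict (\<Phi> h) (carrier N)) (restrict (\<Phi> k) (carrier N))"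
    if "h \<in> carrier H" "k \<in> carrier H" for h k
    using that mult hom[of k] by (auto simp: compose_def fun_eq_iff hom_def)
  then show ?thesis
    using auto by (auto intro!: homI simp: AutoGroup_def BijGroup_def auto_def)
qed

lemma group_semidirect_product:
  assumes N: "group N" and H: "group H" and \<phi>: "\<phi> \<in> hom H (AutoGroup N)"
  shows "group (semidirect_product N H \<phi>)"
proof -
  interpret N: group N by fact
  interpret H: group H by fact
  have auto: "\<phi> h \<in> auto N" if "h \<in> carrier H" for h
    using hom_in_carrier[OF \<phi> that] by (simp add: AutoGroup_def)
  have closed: "\<phi> h n \<in> carrier N" if "h \<in> carrier H" "n \<in> carrier N" for h n
    using auto[OF that(1)] that(2) by (auto simp: auto_def hom_def)
  have mult: "\<phi> h (n \<otimes>\<^bsub>N\<^esub> n') = \<phi> h n \<otimes>\<^bsub>N\<^esub> \<phi> h n'"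
    if "h \<in> carrier H" "n \<in> carrier N" "n' \<in> carrier N" for h n n'
    using auto[OF that(1)] that by (auto simp: auto_def hom_def)
  have comp: "\<phi> (h \<otimes>\<^bsub>H\<^esub> k) n = \<phi> h (\<phi> k n)"
    if "h \<in> carrier H" "k \<in> carrier H" "n \<in> carrier N" for h k n
    using hom_mult[OF \<phi> that(1,2)] auto[OF that(1)] auto[OF that(2)] that(3)
    by (simp add: AutoGroup_def BijGroup_def auto_def compose_def)
  have one: "\<phi> \<one>\<^bsub>H\<^esub> n = n" if "n \<in> carrier N" for n
    using hom_one[OF \<phi> H N.AutoGroup] that by (simp add: AutoGroup_def BijGroup_def)
  show ?thesis
  proof (rule groupI)
    fix x assume "x \<in> carrier (semidirect_product N H \<phi>)"
    then obtain n h where x: "x = (n, h)" "n \<in> carrier N" "h \<in> carrier H"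
      by (auto simp: semidirect_product_def)
    let ?y = "(\<phi> (inv\<^bsub>H\<^esub> h) (inv\<^bsub>N\<^esub> n), inv\<^bsub>H\<^esub> h)"
    have "\<phi> (inv\<^bsub>H\<^esub> h) (inv\<^bsub>N\<^esub> n) \<otimes>\<^bsub>N\<^esub> \<phi> (inv\<^bsub>H\<^esub> h) n = \<phi> (inv\<^bsub>H\<^esub> h) \<one>\<^bsub>N\<^esub>"
      using x by (simp flip: mult)
    moreover have "\<phi> (inv\<^bsub>H\<^esub> h) \<one>\<^bsub>N\<^esub> = \<one>\<^bsub>N\<^esub>"
      using hom_one[of "\<phi> (inv\<^bsub>H\<^esub> h)" N N] auto[of "inv\<^bsub>H\<^esub> h"] x N by (auto simp: auto_def)
    ultimately show "\<exists>y\<in>carrier (semidirect_product N H \<phi>).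
        y \<otimes>\<^bsub>semidirect_product N H \<phi>\<^esub> x = \<one>\<^bsub>semidirect_product N H \<phi>\<^esub>"
      using x closed by (intro bexI[of _ ?y]) (auto simp: semidirect_product_def)
  qed (auto simp: semidirect_product_def closed mult comp one N.m_assoc H.m_assoc)
qed

subsection \<open>\<open>Y(m)\<close> and its automorphisms\<close>

lemma Y_relators_closed: "Y_relators m \<subseteq> carrier (free_group {1..m})"
proof -
  interpret group "free_group {1..m}" by (rule group_free_group)
  show ?thesis by (auto simp: Y_relators_def Let_def free_gen_closed simp del: One_nat_def atLeastAtMost_iff)
qed

lemma group_Y_group: "group (Y_group m)"
  unfolding Y_group_def
  by (intro normal.factorgroup_is_group group.normal_closure_normal group_free_group Y_relators_closed)

lemma Y_gen_closed: "i \<in> {1..m} \<Longrightarrow> Y_gen m i \<in> carrier (Y_group m)"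
  by (auto simp: Y_group_def Y_gen_def carrier_FactGroup free_gen_closed)

lemma Y_group_universal:
  assumes K: "group K" and f: "f \<in> {1..m} \<rightarrow> carrier K"
    and rel: "\<And>i j k::int. i \<in> {1..m} \<Longrightarrow> j \<in> {1..m} \<Longrightarrow> i \<noteq> j \<Longrightarrow>
      (f i [^]\<^bsub>K\<^esub> k \<otimes>\<^bsub>K\<^esub> f j [^]\<^bsub>K\<^esub> k) [^]\<^bsub>K\<^esub> (2::nat) = \<one>\<^bsub>K\<^esub>"
  obtains h where "h \<in> hom (Y_group m) K" "\<And>i. i \<in> {1..m} \<Longrightarrow> h (Y_gen m i) = f i"
proof -
  obtain g where g: "g \<in> hom (free_group {1..m}) K" "\<And>i. i \<in> {1..m} \<Longrightarrow> g (free_gen {1..m} i) = f i"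
    using group.free_group_universal[OF K f] by metis
  interpret g: group_hom "free_group {1..m}" K g
    by (intro group_hom.intro group_hom_axioms.intro group_free_group K g)
  have "g r = \<one>\<^bsub>K\<^esub>" if "r \<in> Y_relators m" for r
    using that by (auto simp: Y_relators_def Let_def free_gen_closed g g.hom_nat_pow g.hom_int_pow rel
      simp del: One_nat_def atLeastAtMost_iff)
  from group.presented_universal[OF group_free_group Y_relators_closed K g(1) this]
  obtain h where h: "h \<in> hom (Y_group m) K"
    "\<And>x. x \<in> carrier (free_group {1..m}) \<Longrightarrow>
       h (normal_closure (free_group {1..m}) (Y_relators m) #>\<^bsub>free_group {1..m}\<^esub> x) = g x"
    unfolding Y_group_def by metis
  show ?thesis
    by (rule that[OF h(1)]) (simp add: Y_gen_def h(2) free_gen_closed g(2) del: One_nat_def atLeastAtMost_iff)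
qed

lemma Y_group_hom_eqI:
  assumes K: "group K" and h: "h \<in> hom (Y_group m) K" and k: "k \<in> hom (Y_group m) K"
    and eq: "\<And>i. i \<in> {1..m} \<Longrightarrow> h (Y_gen m i) = k (Y_gen m i)"
    and U: "U \<in> carrier (Y_group m)"
  shows "h U = k U"
proof -
  let ?P = "\<lambda>h k. \<forall>i\<in>{1..m}. h (free_gen {1..m} i) = k (free_gen {1..m} i)"
  show ?thesis
    by (rule group.presented_hom_eqI[OF group_free_group Y_relators_closed h[unfolded Y_group_def]
          k[unfolded Y_group_def], where P = ?P])
      (use eq U K in \<open>auto simp: Y_gen_def Y_group_def intro: free_group_hom_eqI\<close>)
qed

lemma Y_gen_relation:
  assumes "i \<in> {1..m}" "j \<in> {1..m}" "i \<noteq> j"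
  shows "(Y_gen m i [^]\<^bsub>Y_group m\<^esub> (k::int) \<otimes>\<^bsub>Y_group m\<^esub> Y_gen m j [^]\<^bsub>Y_group m\<^esub> k)
    [^]\<^bsub>Y_group m\<^esub> (2::nat) = \<one>\<^bsub>Y_group m\<^esub>"
proof -
  let ?F = "free_group {1..m}" and ?N = "normal_closure (free_group {1..m}) (Y_relators m)"
  interpret F: group ?F by (rule group_free_group)
  interpret N: normal ?N ?F by (rule F.normal_closure_normal[OF Y_relators_closed])
  interpret q: group_hom ?F "Y_group m" "\<lambda>x. ?N #>\<^bsub>?F\<^esub> x"
    unfolding Y_group_def
    by (intro group_hom.intro group_hom_axioms.intro F.is_group N.factorgroup_is_group N.r_coset_hom_Mod)
  let ?r = "(free_gen {1..m} i [^]\<^bsub>?F\<^esub> k \<otimes>\<^bsub>?F\<^esub> free_gen {1..m} j [^]\<^bsub>?F\<^esub> k) [^]\<^bsub>?F\<^esub> (2::nat)"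
  have "?r \<in> Y_relators m" using assms by (auto simp: Y_relators_def Let_def)
  then have "?r \<in> ?N" using F.normal_closure_superset by blast
  then have "?N #>\<^bsub>?F\<^esub> ?r = \<one>\<^bsub>Y_group m\<^esub>"
    by (simp add: Y_group_def F.coset_join2 N.is_subgroup N.mem_carrier del: One_nat_def)
  then show ?thesis
    using assms by (simp add: Y_gen_def free_gen_closed q.hom_nat_pow q.hom_int_pow del: One_nat_def atLeastAtMost_iff)
qed

lemma Y_endo_ex:
  assumes "\<sigma> \<in> carrier (sym_group m)"
  shows "\<exists>h\<in>hom (Y_group m) (Y_group m). \<forall>i\<in>{1..m}. h (Y_gen m i) =
     (if c = 0 then Y_gen m (\<sigma> i) else inv\<^bsub>Y_group m\<^esub> (Y_gen m (\<sigma> i)))"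
proof -
  interpret group "Y_group m" by (rule group_Y_group)
  have \<sigma>: "\<sigma> permutes {1..m}" using assms by (simp add: sym_group_def)
  let ?f = "\<lambda>i. if c = 0 then Y_gen m (\<sigma> i) else inv\<^bsub>Y_group m\<^esub> (Y_gen m (\<sigma> i))"
  have "?f \<in> {1..m} \<rightarrow> carrier (Y_group m)"
    using permutes_in_image[OF \<sigma>] by (simp add: Y_gen_closed Pi_iff del: atLeastAtMost_iff)
  moreover have "(?f i [^]\<^bsub>Y_group m\<^esub> k \<otimes>\<^bsub>Y_group m\<^esub> ?f j [^]\<^bsub>Y_group m\<^esub> k) [^]\<^bsub>Y_group m\<^esub> (2::nat)
      = \<one>\<^bsub>Y_group m\<^esub>" if "i \<in> {1..m}" "j \<in> {1..m}" "i \<noteq> j" for i j and k :: int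
  proof -
    have ij: "\<sigma> i \<in> {1..m}" "\<sigma> j \<in> {1..m}" "\<sigma> i \<noteq> \<sigma> j"
      using that permutes_in_image[OF \<sigma>] permutes_inj[OF \<sigma>] by (simp_all add: inj_eq del: atLeastAtMost_iff)
    show ?thesis
      using Y_gen_relation[OF ij, of k] Y_gen_relation[OF ij, of "-k"] Y_gen_closed[OF ij(1)] Y_gen_closed[OF ij(2)]
      by (simp add: int_pow_inv int_pow_neg)
  qed
  ultimately obtain h where "h \<in> hom (Y_group m) (Y_group m)" "\<And>i. i \<in> {1..m} \<Longrightarrow> h (Y_gen m i) = ?f i"
    by (rule Y_group_universal[OF group_Y_group]) blast+
  then show ?thesis by blast
qed

lemma
  shows Y_action_hom: "Y_action m \<in> hom (sym_group m \<times>\<times> integer_mod_group 2) (AutoGroup (Y_group m))"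
    and Y_action_gen: "\<And>\<sigma> c i. \<sigma> \<in> carrier (sym_group m) \<Longrightarrow> i \<in> {1..m} \<Longrightarrow> Y_action m (\<sigma>, c) (Y_gen m i) =
      (if c = 0 then Y_gen m (\<sigma> i) else inv\<^bsub>Y_group m\<^esub> (Y_gen m (\<sigma> i)))"
proof -
  let ?Y = "Y_group m" and ?H = "sym_group m \<times>\<times> integer_mod_group 2"
  interpret group ?Y by (rule group_Y_group)
  let ?v = "\<lambda>\<sigma> (c::int) i. if c = 0 then Y_gen m (\<sigma> i) else inv\<^bsub>?Y\<^esub> (Y_gen m (\<sigma> i))"
  have H: "group ?H" by (intro DirProd_group sym_group_is_group group_integer_mod_group)
  have "\<forall>x. \<exists>h. fst x \<in> carrier (sym_group m) \<longrightarrow> h \<in> hom ?Y ?Y \<and> (\<forall>i\<in>{1..m}. h (Y_gen m i) = ?v (fst x) (snd x) i)"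
    using Y_endo_ex by metis
  then obtain \<Phi> where \<Phi>: "\<And>x. fst x \<in> carrier (sym_group m) \<Longrightarrow> \<Phi> x \<in> hom ?Y ?Y"
    and gen: "\<And>x i. fst x \<in> carrier (sym_group m) \<Longrightarrow> i \<in> {1..m} \<Longrightarrow> \<Phi> x (Y_gen m i) = ?v (fst x) (snd x) i"
    by metis
  have perm: "\<sigma> i \<in> {1..m}" if "\<sigma> \<in> carrier (sym_group m)" "i \<in> {1..m}" for \<sigma> i
    using that by (metis permutes_in_image sym_group_carrier)
  have inv: "\<Phi> x (inv\<^bsub>?Y\<^esub> y) = inv\<^bsub>?Y\<^esub> (\<Phi> x y)" if "fst x \<in> carrier (sym_group m)" "y \<in> carrier ?Y" for x y
    using group_hom.hom_inv[of ?Y ?Y "\<Phi> x" y] \<Phi>[OF that(1)] that(2)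
    by (simp add: group_hom_def group_hom_axioms_def is_group)
  have hom: "(\<lambda>x. restrict (\<Phi> x) (carrier ?Y)) \<in> hom ?H (AutoGroup ?Y)"
  proof (rule hom_AutoGroupI[OF group_Y_group H])
    show "\<Phi> x \<in> hom ?Y ?Y" if "x \<in> carrier ?H" for x
      using \<Phi> that by (auto simp: DirProd_def)
    show "\<Phi> \<one>\<^bsub>?H\<^esub> n = n" if "n \<in> carrier ?Y" for n
      by (rule Y_group_hom_eqI[OF group_Y_group _ _ _ that, where k = "\<lambda>x. x"])
        (use \<Phi>[of "(id, 0)"] gen[of "(id, 0)"] in
          \<open>auto simp: DirProd_def hom_def sym_group_def permutes_id\<close>)
    show "\<Phi> (x \<otimes>\<^bsub>?H\<^esub> y) n = \<Phi> x (\<Phi> y n)"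
      if x: "x \<in> carrier ?H" and y: "y \<in> carrier ?H" and n: "n \<in> carrier ?Y" for x y n
    proof (rule Y_group_hom_eqI[OF group_Y_group _ _ _ n, where k = "\<lambda>n. \<Phi> x (\<Phi> y n)"])
      obtain \<sigma> c \<rho> d where xy: "x = (\<sigma>, c)" "y = (\<rho>, d)" by (cases x, cases y)
      have xy': "\<sigma> \<in> carrier (sym_group m)" "\<rho> \<in> carrier (sym_group m)" "\<sigma> \<circ> \<rho> \<in> carrier (sym_group m)"
        "c \<in> {0, 1}" "d \<in> {0, 1}"
        using x y xy by (auto simp: carrier_integer_mod_group sym_group_def permutes_compose)
      show "\<Phi> (x \<otimes>\<^bsub>?H\<^esub> y) \<in> hom ?Y ?Y"
        using xy xy' \<Phi> by (simp add: sym_group_mult)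
      show "(\<lambda>n. \<Phi> x (\<Phi> y n)) \<in> hom ?Y ?Y"
        using Group.hom_compose[OF \<Phi>[of y] \<Phi>[of x]] xy xy' by (simp add: o_def)
      show "\<Phi> (x \<otimes>\<^bsub>?H\<^esub> y) (Y_gen m i) = \<Phi> x (\<Phi> y (Y_gen m i))" if i: "i \<in> {1..m}" for i
        using xy xy' i perm[OF xy'(2) i] perm[OF xy'(1) perm[OF xy'(2) i]] Y_gen_closed
        by (auto simp: sym_group_mult gen inv simp del: atLeastAtMost_iff)
    qed
  qed
  have eq: "Y_action m (\<sigma>, c) = restrict (\<Phi> (\<sigma>, if c = 0 then 0 else 1)) (carrier ?Y)"
    if \<sigma>: "\<sigma> \<in> carrier (sym_group m)" for \<sigma> c
  proof -
    define d :: int where "d = (if c = 0 then 0 else 1)"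
    have f: "restrict (\<Phi> (\<sigma>, d)) (carrier ?Y) \<in> auto ?Y"
      using hom_in_carrier[OF hom, of "(\<sigma>, d)"] \<sigma>
      by (simp add: AutoGroup_def carrier_integer_mod_group d_def)
    have "(THE f. f \<in> auto ?Y \<and> (\<forall>i\<in>{1..m}. f (Y_gen m i) = ?v \<sigma> c i)) = restrict (\<Phi> (\<sigma>, d)) (carrier ?Y)"
    proof (rule the_equality)
      show "restrict (\<Phi> (\<sigma>, d)) (carrier ?Y) \<in> auto ?Y \<and>
          (\<forall>i\<in>{1..m}. restrict (\<Phi> (\<sigma>, d)) (carrier ?Y) (Y_gen m i) = ?v \<sigma> c i)"
        using f gen[of "(\<sigma>, d)"] \<sigma> Y_gen_closed by (simp add: d_def del: atLeastAtMost_iff)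
      then have 1: "\<And>i. i \<in> {1..m} \<Longrightarrow> restrict (\<Phi> (\<sigma>, d)) (carrier ?Y) (Y_gen m i) = ?v \<sigma> c i" by blast
      fix g assume g: "g \<in> auto ?Y \<and> (\<forall>i\<in>{1..m}. g (Y_gen m i) = ?v \<sigma> c i)"
      show "g = restrict (\<Phi> (\<sigma>, d)) (carrier ?Y)"
      proof (rule extensionalityI[where A = "carrier ?Y"])
        show "g x = restrict (\<Phi> (\<sigma>, d)) (carrier ?Y) x" if "x \<in> carrier ?Y" for x
          by (rule Y_group_hom_eqI[OF group_Y_group _ _ _ that]) (use f g 1 in \<open>auto simp only: auto_def Int_iff\<close>)
      qed (use f g in \<open>auto simp: auto_def Bij_def\<close>)
    qed
    then show ?thesis by (simp add: Y_action_def d_def)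
  qed
  show "Y_action m (\<sigma>, c) (Y_gen m i) = ?v \<sigma> c i"
    if "\<sigma> \<in> carrier (sym_group m)" "i \<in> {1..m}" for \<sigma> c i
    using that eq gen[of "(\<sigma>, if c = 0 then 0 else 1)" i] Y_gen_closed by (simp del: atLeastAtMost_iff)
  have "Y_action m x = restrict (\<Phi> x) (carrier ?Y)" if "x \<in> carrier ?H" for x
  proof -
    obtain \<sigma> c where x: "x = (\<sigma>, c)" by (cases x)
    then have "\<sigma> \<in> carrier (sym_group m)" "c = 0 \<or> c = 1"
      using that by (auto simp: carrier_integer_mod_group)
    then show ?thesis using eq[of \<sigma> c] x by auto
  qed
  then show "Y_action m \<in> hom ?H (AutoGroup ?Y)"
    using group.hom_restrict[OF H hom] by simp
qed

subsection \<open>\<open>y(m)\<close> and the automorphism \<open>\<tau>\<close>\<close>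

lemma group_y_free: "group (y_free m)"
  by (intro group_free_product group_integer_group sym_group_is_group)

lemma y_inl_closed: "y_inl m k \<in> carrier (y_free m)"
  using hom_in_carrier[OF free_product_inl_hom[OF group_integer_group, of "sym_group m"], of k] by simp

lemma y_inr_closed: "\<sigma> \<in> carrier (sym_group m) \<Longrightarrow> y_inr m \<sigma> \<in> carrier (y_free m)"
  using hom_in_carrier[OF free_product_inr_hom[OF sym_group_is_group]] .

lemma adj_transpose_closed: "1 \<le> i \<Longrightarrow> i + 1 \<le> m \<Longrightarrow> transpose i (i + 1) \<in> carrier (sym_group m)"
  by (simp add: sym_group_def permutes_swap_id)

lemma group_conj_closed:
  "group G \<Longrightarrow> x \<in> carrier G \<Longrightarrow> y \<in> carrier G \<Longrightarrow> group_conj G x y \<in> carrier G"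
  by (simp add: group_conj_def group.is_monoid monoid.m_closed group.inv_closed)

lemma group_comm_closed:
  "group G \<Longrightarrow> x \<in> carrier G \<Longrightarrow> y \<in> carrier G \<Longrightarrow> group_comm G x y \<in> carrier G"
  by (simp add: group_comm_def group.is_monoid monoid.m_closed group.inv_closed)

lemma (in group_hom) hom_group_conj:
  "x \<in> carrier G \<Longrightarrow> y \<in> carrier G \<Longrightarrow> h (group_conj G x y) = group_conj H (h x) (h y)"
  by (simp add: group_conj_def)

lemma (in group_hom) hom_group_comm:
  "x \<in> carrier G \<Longrightarrow> y \<in> carrier G \<Longrightarrow> h (group_comm G x y) = group_comm H (h x) (h y)"
  by (simp add: group_comm_def)

lemma y_relators_closed:
  assumes "m \<ge> 2"
  shows "y_relators m \<subseteq> carrier (y_free m)"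
proof -
  interpret group "y_free m" by (rule group_y_free)
  have 1: "transpose 1 (1 + 1) \<in> carrier (sym_group m)"
    by (rule adj_transpose_closed) (use assms in auto)
  have 2: "transpose i (i + 1) \<in> carrier (sym_group m)" if "2 \<le> i" "i \<le> m - 1" for i
    by (rule adj_transpose_closed) (use assms that in auto)
  show ?thesis
    unfolding y_relators_def Let_def
    using 1 2 by (auto intro!: group_comm_closed group_conj_closed is_group y_inr_closed y_inl_closed
        int_pow_closed m_closed simp del: One_nat_def Suc_eq_plus1 add_2_eq_Suc' one_add_one Num.add_2_eq_Suc Nat.add_0_right add_Suc_right)
qed

lemma group_y_group: "m \<ge> 2 \<Longrightarrow> group (y_group m)"
  unfolding y_group_def
  by (intro normal.factorgroup_is_group group.normal_closure_normal group_y_free y_relators_closed)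

lemma y_gen_closed: "y_gen m \<in> carrier (y_group m)"
  by (auto simp: y_group_def y_gen_def carrier_FactGroup y_inl_closed)

lemma y_perm_closed: "\<sigma> \<in> carrier (sym_group m) \<Longrightarrow> y_perm m \<sigma> \<in> carrier (y_group m)"
  by (auto simp: y_group_def y_perm_def carrier_FactGroup y_inr_closed)

lemma y_quotient_hom:
  assumes "m \<ge> 2"
  shows "group_hom (y_free m) (y_group m)
    (\<lambda>x. normal_closure (y_free m) (y_relators m) #>\<^bsub>y_free m\<^esub> x)"
  unfolding y_group_def
  by (intro group_hom.intro group_hom_axioms.intro normal.r_coset_hom_Mod normal.factorgroup_is_group
      group.normal_closure_normal y_relators_closed group_y_free assms)

lemma y_perm_hom:
  assumes "m \<ge> 2"
  shows "y_perm m \<in> hom (sym_group m) (y_group m)"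
  using Group.hom_compose[OF free_product_inr_hom[OF sym_group_is_group] group_hom.homh[OF y_quotient_hom[OF assms]]]
  by (simp add: y_perm_def[abs_def] o_def)

lemma y_group_universal:
  assumes m: "m \<ge> 2" and K: "group K" and a: "a \<in> carrier K" and q: "q \<in> hom (sym_group m) K"
    and comm: "\<And>k::int. group_comm K (q (transpose 1 2)) (group_conj K (q (transpose 1 2)) (a [^]\<^bsub>K\<^esub> k)) = \<one>\<^bsub>K\<^esub>"
    and inv: "\<And>i. 2 \<le> i \<Longrightarrow> i \<le> m - 1 \<Longrightarrow> group_conj K a (q (transpose i (i + 1))) = inv\<^bsub>K\<^esub> a"
  obtains h where "h \<in> hom (y_group m) K" "h (y_gen m) = a"
    "\<And>\<sigma>. \<sigma> \<in> carrier (sym_group m) \<Longrightarrow> h (y_perm m \<sigma>) = q \<sigma>"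
proof -
  interpret K: group K by fact
  have "(\<lambda>k::int. a [^]\<^bsub>K\<^esub> k) \<in> hom integer_group K"
    using a by (auto intro!: homI simp: K.int_pow_mult)
  from K.free_product_universal[OF group_integer_group sym_group_is_group this q]
  obtain g where g: "g \<in> hom (y_free m) K" "\<And>k. g (y_inl m k) = a [^]\<^bsub>K\<^esub> k"
    "\<And>\<sigma>. \<sigma> \<in> carrier (sym_group m) \<Longrightarrow> g (y_inr m \<sigma>) = q \<sigma>"
    by (metis UNIV_I carrier_integer_group)
  interpret F: group "y_free m" by (rule group_y_free)
  interpret g: group_hom "y_free m" K g
    by (intro group_hom.intro group_hom_axioms.intro group_y_free K g)
  have s: "transpose 1 2 \<in> carrier (sym_group m)"
    using adj_transpose_closed[of 1 m] m by (simp add: numeral_2_eq_2)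
  have si: "transpose i (i + 1) \<in> carrier (sym_group m)" if "2 \<le> i" "i \<le> m - 1" for i
    by (rule adj_transpose_closed) (use m that in auto)
  have "g r = \<one>\<^bsub>K\<^esub>" if r: "r \<in> y_relators m" for r
  proof -
    from r consider
      k :: int where "r = group_comm (y_free m) (y_inr m (transpose 1 2))
        (group_conj (y_free m) (y_inr m (transpose 1 2)) (y_inl m 1 [^]\<^bsub>y_free m\<^esub> k))"
    | i where "2 \<le> i" "i \<le> m - 1" "r = group_conj (y_free m) (y_inl m 1) (y_inr m (transpose i (i + 1)))
        \<otimes>\<^bsub>y_free m\<^esub> y_inl m 1"
      unfolding y_relators_def Let_def one_add_one by blast
    then show ?thesis
    proof cases
      case (1 k)
      then show ?thesis
        using s comm[of k] a
        by (simp add: g.hom_group_comm g.hom_group_conj group_conj_closed group_y_free y_inr_closed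
            y_inl_closed g g.hom_int_pow del: One_nat_def)
    next
      case (2 i)
      then show ?thesis
        using si[of i] inv[of i] a
        by (simp add: g.hom_group_conj group_conj_closed group_y_free y_inr_closed y_inl_closed g)
    qed
  qed
  from F.presented_universal[OF y_relators_closed[OF m] K g(1) this]
  obtain h where h: "h \<in> hom (y_group m) K"
    "\<And>x. x \<in> carrier (y_free m) \<Longrightarrow>
       h (normal_closure (y_free m) (y_relators m) #>\<^bsub>y_free m\<^esub> x) = g x"
    unfolding y_group_def by metis
  show ?thesis
    by (rule that[OF h(1)]) (use a in \<open>simp_all add: y_gen_def y_perm_def h(2) y_inl_closed y_inr_closed g\<close>)
qed

lemma y_group_hom_eqI:
  assumes m: "m \<ge> 2" and K: "group K" and h: "h \<in> hom (y_group m) K" and k: "k \<in> hom (y_group m) K"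
    and gen: "h (y_gen m) = k (y_gen m)"
    and perm: "\<And>\<sigma>. \<sigma> \<in> carrier (sym_group m) \<Longrightarrow> h (y_perm m \<sigma>) = k (y_perm m \<sigma>)"
    and U: "U \<in> carrier (y_group m)"
  shows "h U = k U"
proof (rule group.presented_hom_eqI[OF group_y_free y_relators_closed[OF m] h[unfolded y_group_def]
      k[unfolded y_group_def] _ _ U[unfolded y_group_def]])
  let ?P = "\<lambda>h k. h (y_inl m 1) = k (y_inl m 1) \<and>
    (\<forall>\<sigma>\<in>carrier (sym_group m). h (y_inr m \<sigma>) = k (y_inr m \<sigma>))"
  show "?P (\<lambda>x. h (normal_closure (y_free m) (y_relators m) #>\<^bsub>y_free m\<^esub> x))
           (\<lambda>x. k (normal_closure (y_free m) (y_relators m) #>\<^bsub>y_free m\<^esub> x))"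
    using gen perm by (simp add: y_gen_def y_perm_def)
  fix f g x assume f: "f \<in> hom (y_free m) K" and g: "g \<in> hom (y_free m) K"
    and x: "x \<in> carrier (y_free m)" and P: "?P f g"
  show "f x = g x"
  proof (rule free_product_hom_eqI[OF group_integer_group sym_group_is_group K f g _ _ x])
    fix k :: int
    have inl: "y_inl m k = y_inl m 1 [^]\<^bsub>y_free m\<^esub> k"
      using hom_int_pow[OF free_product_inl_hom[OF group_integer_group] _ group_integer_group group_y_free,
          where x = 1 and n = k] by simp
    show "f (y_inl m k) = g (y_inl m k)"
      unfolding inl
      using P hom_int_pow[OF f y_inl_closed group_y_free K] hom_int_pow[OF g y_inl_closed group_y_free K]
      by simp
  qed (use P in blast)
qed

lemma
  assumes m: "m \<ge> 2"
  shows y_group_comm_relation: "group_comm (y_group m) (y_perm m (transpose 1 2))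
      (group_conj (y_group m) (y_perm m (transpose 1 2)) (y_gen m [^]\<^bsub>y_group m\<^esub> (k::int))) = \<one>\<^bsub>y_group m\<^esub>"
    and y_group_inv_relation: "2 \<le> i \<Longrightarrow> i \<le> m - 1 \<Longrightarrow>
      group_conj (y_group m) (y_gen m) (y_perm m (transpose i (i + 1))) = inv\<^bsub>y_group m\<^esub> (y_gen m)"
proof -
  let ?N = "normal_closure (y_free m) (y_relators m)"
  interpret F: group "y_free m" by (rule group_y_free)
  interpret N: normal ?N "y_free m" by (rule F.normal_closure_normal[OF y_relators_closed[OF m]])
  interpret q: group_hom "y_free m" "y_group m" "\<lambda>x. ?N #>\<^bsub>y_free m\<^esub> x" by (rule y_quotient_hom[OF m])
  have rel: "?N #>\<^bsub>y_free m\<^esub> r = \<one>\<^bsub>y_group m\<^esub>" if "r \<in> y_relators m" for r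
  proof -
    have "r \<in> ?N" using that F.normal_closure_superset by blast
    then show ?thesis by (simp add: y_group_def F.coset_join2 N.is_subgroup N.mem_carrier)
  qed
  have s: "transpose 1 2 \<in> carrier (sym_group m)"
    using adj_transpose_closed[of 1 m] m by (simp add: numeral_2_eq_2)
  have "group_comm (y_free m) (y_inr m (transpose 1 2))
      (group_conj (y_free m) (y_inr m (transpose 1 2)) (y_inl m 1 [^]\<^bsub>y_free m\<^esub> k)) \<in> y_relators m"
    unfolding y_relators_def Let_def one_add_one by blast
  from rel[OF this] show "group_comm (y_group m) (y_perm m (transpose 1 2))
      (group_conj (y_group m) (y_perm m (transpose 1 2)) (y_gen m [^]\<^bsub>y_group m\<^esub> k)) = \<one>\<^bsub>y_group m\<^esub>"
    using s by (simp add: q.hom_group_comm q.hom_group_conj group_conj_closed group_y_free y_inr_closed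
            y_inl_closed q.hom_int_pow y_gen_def y_perm_def del: One_nat_def)
  assume i: "2 \<le> i" "i \<le> m - 1"
  have si: "transpose i (i + 1) \<in> carrier (sym_group m)"
    by (rule adj_transpose_closed) (use m i in auto)
  have "group_conj (y_free m) (y_inl m 1) (y_inr m (transpose i (i + 1))) \<otimes>\<^bsub>y_free m\<^esub> y_inl m 1
      \<in> y_relators m"
    unfolding y_relators_def Let_def using i by blast
  from rel[OF this]
  have "group_conj (y_group m) (y_gen m) (y_perm m (transpose i (i + 1))) \<otimes>\<^bsub>y_group m\<^esub> y_gen m = \<one>\<^bsub>y_group m\<^esub>"
    using si by (simp add: q.hom_group_conj group_conj_closed group_y_free y_inr_closed y_inl_closed
        y_gen_def y_perm_def)
  then show "group_conj (y_group m) (y_gen m) (y_perm m (transpose i (i + 1))) = inv\<^bsub>y_group m\<^esub> (y_gen m)"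
    using q.H.inv_equality y_gen_closed y_perm_closed[OF si] group_conj_closed[OF q.H.is_group] by metis
qed

lemma
  assumes m: "m \<ge> 2"
  shows tau_auto_auto: "tau_auto m \<in> auto (y_group m)"
    and tau_auto_gen: "tau_auto m (y_gen m) = inv\<^bsub>y_group m\<^esub> (y_gen m)"
    and tau_auto_perm: "\<And>\<sigma>. \<sigma> \<in> carrier (sym_group m) \<Longrightarrow> tau_auto m (y_perm m \<sigma>) = y_perm m \<sigma>"
    and tau_action_hom: "tau_action m \<in> hom (integer_mod_group 2) (AutoGroup (y_group m))"
proof -
  let ?y = "y_group m" and ?a = "y_gen m"
  interpret y: group ?y by (rule group_y_group[OF m])
  have s: "y_perm m (transpose 1 2) \<in> carrier ?y"
    using adj_transpose_closed[of 1 m] m by (intro y_perm_closed) (simp add: numeral_2_eq_2)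
  have 1: "group_comm ?y (y_perm m (transpose 1 2))
      (group_conj ?y (y_perm m (transpose 1 2)) (inv\<^bsub>?y\<^esub> ?a [^]\<^bsub>?y\<^esub> (k::int))) = \<one>\<^bsub>?y\<^esub>" for k
    using y_group_comm_relation[OF m, of "-k"] by (simp add: y.int_pow_inv y.int_pow_neg y_gen_closed)
  have 2: "group_conj ?y (inv\<^bsub>?y\<^esub> ?a) (y_perm m (transpose i (i + 1))) = inv\<^bsub>?y\<^esub> (inv\<^bsub>?y\<^esub> ?a)"
    if i: "2 \<le> i" "i \<le> m - 1" for i
  proof -
    have si: "y_perm m (transpose i (i + 1)) \<in> carrier ?y"
      by (intro y_perm_closed adj_transpose_closed) (use i in auto)
    have "group_conj ?y (inv\<^bsub>?y\<^esub> ?a) (y_perm m (transpose i (i + 1)))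
        = inv\<^bsub>?y\<^esub> (group_conj ?y ?a (y_perm m (transpose i (i + 1))))"
      using si y_gen_closed[of m] by (simp add: group_conj_def y.inv_mult_group y.m_assoc)
    then show ?thesis using y_group_inv_relation[OF m i] by simp
  qed
  obtain h where h: "h \<in> hom ?y ?y" "h ?a = inv\<^bsub>?y\<^esub> ?a"
    "\<And>\<sigma>. \<sigma> \<in> carrier (sym_group m) \<Longrightarrow> h (y_perm m \<sigma>) = y_perm m \<sigma>"
    using y_group_universal[OF m y.is_group y.inv_closed[OF y_gen_closed] y_perm_hom[OF m] 1 2] by blast
  interpret h: group_hom ?y ?y h
    by (intro group_hom.intro group_hom_axioms.intro y.is_group h)
  have invol: "h (h x) = x" if "x \<in> carrier ?y" for x
    by (rule y_group_hom_eqI[OF m y.is_group _ _ _ _ that, where h = "\<lambda>x. h (h x)" and k = "\<lambda>x. x"])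
      (use Group.hom_compose[OF h(1) h(1)] y_gen_closed[of m] in \<open>auto simp: o_def h hom_def\<close>)
  define \<Phi> :: "int \<Rightarrow> _" where "\<Phi> c = (if c = 0 then (\<lambda>x. x) else h)" for c
  have hom: "(\<lambda>c. restrict (\<Phi> c) (carrier ?y)) \<in> hom (integer_mod_group 2) (AutoGroup ?y)"
  proof (rule hom_AutoGroupI)
    show "\<Phi> c \<in> hom ?y ?y" for c using h by (auto simp: \<Phi>_def hom_def)
    show "\<Phi> (c \<otimes>\<^bsub>integer_mod_group 2\<^esub> d) n = \<Phi> c (\<Phi> d n)"
      if "c \<in> carrier (integer_mod_group 2)" "d \<in> carrier (integer_mod_group 2)" "n \<in> carrier ?y" for c d n
    proof -
      have "c \<in> {0, 1}" "d \<in> {0, 1}" using that by (auto simp: carrier_integer_mod_group)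
      then show ?thesis using invol that by (auto simp: \<Phi>_def)
    qed
  qed (auto simp: \<Phi>_def y.is_group)
  have au: "restrict h (carrier ?y) \<in> auto ?y"
    using hom_in_carrier[OF hom, of 1] by (simp add: AutoGroup_def \<Phi>_def)
  have tau: "tau_auto m = restrict h (carrier ?y)"
    unfolding tau_auto_def
  proof (rule the_equality)
    show *: "restrict h (carrier ?y) \<in> auto ?y \<and> restrict h (carrier ?y) ?a = inv\<^bsub>?y\<^esub> ?a \<and>
      (\<forall>\<sigma>\<in>carrier (sym_group m). restrict h (carrier ?y) (y_perm m \<sigma>) = y_perm m \<sigma>)"
      using au h y_gen_closed y_perm_closed by simp
    fix g assume g: "g \<in> auto ?y \<and> g ?a = inv\<^bsub>?y\<^esub> ?a \<and>
      (\<forall>\<sigma>\<in>carrier (sym_group m). g (y_perm m \<sigma>) = y_perm m \<sigma>)"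
    show "g = restrict h (carrier ?y)"
    proof (rule extensionalityI[where A = "carrier ?y"])
      show "g x = restrict h (carrier ?y) x" if "x \<in> carrier ?y" for x
        by (rule y_group_hom_eqI[OF m y.is_group _ _ _ _ that])
          (use * g in \<open>auto simp only: auto_def Int_iff\<close>)
    qed (use g in \<open>auto simp: auto_def Bij_def\<close>)
  qed
  show "tau_auto m \<in> auto ?y" "tau_auto m ?a = inv\<^bsub>?y\<^esub> ?a"
    "\<And>\<sigma>. \<sigma> \<in> carrier (sym_group m) \<Longrightarrow> tau_auto m (y_perm m \<sigma>) = y_perm m \<sigma>"
    using tau au h y_gen_closed y_perm_closed by simp_all
  have "tau_action m = (\<lambda>c. restrict (\<Phi> c) (carrier ?y))"
    by (auto simp: fun_eq_iff tau_action_def tau \<Phi>_def AutoGroup_def BijGroup_def)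
  then show "tau_action m \<in> hom (integer_mod_group 2) (AutoGroup ?y)" using hom by simp
qed

corollary group_ytilde_group: "m \<ge> 2 \<Longrightarrow> group (ytilde_group m)"
  unfolding ytilde_group_def
  by (intro group_semidirect_product group_y_group group_integer_mod_group tau_action_hom)

corollary group_Y_semidirect:
  "group (semidirect_product (Y_group m) (sym_group m \<times>\<times> integer_mod_group 2) (Y_action m))"
  by (intro group_semidirect_product group_Y_group DirProd_group sym_group_is_group
      group_integer_mod_group Y_action_hom)

end

theory Submission
  imports Defs
begin

text \<open>The proof rests on one substitution. In \<open>y(m)\<close> an adjacent transposition \<open>s\<^sub>i\<close> with \<open>i \<ge> 2\<close>
  inverts \<open>a\<close>, and so does \<open>\<tau>\<close>; hence their product centralises \<open>a\<close>. Let \<open>\<sigma>\<close> in \<open>S\<^sub>m\<close> correspond to the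
  twisted permutation \<open>\<sigma>' = \<sigma> \<tau>\<^sup>p\<close>, where \<open>p\<close> is the parity of \<open>\<sigma>\<close>. Since \<open>\<tau>\<close> centralises \<open>S\<^sub>m\<close>, the
  map \<open>\<sigma> \<mapsto> \<sigma>'\<close> is a homomorphism, so its image together with \<open>\<tau>\<close> generates the same \<open>S\<^sub>m \<times> C\<^sub>2\<close> as
  \<open>S\<^sub>m\<close> and \<open>\<tau>\<close>.

  The stabiliser of the point 1 in \<open>S\<^sub>m\<close> is generated by the \<open>s\<^sub>i\<close> with \<open>i \<ge> 2\<close>, so its twisted copy
  centralises \<open>a\<close> (\<open>centralised_by_point_stabiliser\<close>). Consequently the conjugate of \<open>a\<close> by
  \<open>\<sigma>'\<close> depends only on \<open>i = \<sigma> 1\<close>; call it \<open>a\<^sub>i\<close>. The twisted symmetric group permutes the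
  \<open>a\<^sub>i\<close> naturally, and \<open>\<tau>\<close> inverts each of them.

  What is left of the presentation of \<open>y(m)\<close> is that \<open>s\<^sub>1\<close> commutes with its conjugate by each power \<open>a\<^sup>k\<close>.
  Two involutions commute if and only if their product squares to 1, and the product of
  \<open>s\<^sub>1\<close> with such a conjugate is, up to inversion and the sign of \<open>k\<close>, the element \<open>a\<^sub>1\<^sup>k a\<^sub>2\<^sup>k\<close>
  (\<open>involution_commutes_with_conjugate_iff\<close>). So these relations say exactly
  \<open>(a\<^sub>1\<^sup>k a\<^sub>2\<^sup>k)\<^sup>2 = 1\<close>, and because \<open>S\<^sub>m\<close> is doubly transitive they are equivalent to all the defining
  relations of \<open>Y(m)\<close> (\<open>Y_group_universal_conjugates\<close>).

  Therefore the universal properties of the two presentations give homomorphisms in both directions,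
  \<open>a \<mapsto> a\<^sub>1\<close>, \<open>\<sigma> \<mapsto> \<sigma> \<tau>\<^sup>p\<close>, \<open>\<tau> \<mapsto> \<tau>\<close> (\<open>ytilde_to_semidirect\<close>) and
  \<open>a\<^sub>i \<mapsto>\<close> the conjugate of \<open>a\<close> above, \<open>\<sigma> \<mapsto> \<sigma> \<tau>\<^sup>p\<close>, \<open>\<tau> \<mapsto> \<tau>\<close> (\<open>semidirect_to_ytilde\<close>), and both
  composites fix the generators.\<close>

section \<open>Conjugation as a left action\<close>

text \<open>In a semidirect product \<open>h\<close> acts by \<open>n \<mapsto> h n h\<^sup>-\<^sup>1\<close>, whereas \<open>group_conj\<close> is the right action
  \<open>n \<mapsto> h\<^sup>-\<^sup>1 n h\<close> of the presentations. For an involution \<open>h\<close> the two agree,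
  which carries the relations \<open>a\<^sup>s = a\<^sup>-\<^sup>1\<close> over to the left action.\<close>

definition conj_by :: "('a, 'b) monoid_scheme \<Rightarrow> 'a \<Rightarrow> 'a \<Rightarrow> 'a" where
  "conj_by G g x = g \<otimes>\<^bsub>G\<^esub> x \<otimes>\<^bsub>G\<^esub> inv\<^bsub>G\<^esub> g"

context group
begin

lemma inv_mult_cancel:
  assumes "x \<in> carrier G" "y \<in> carrier G"
  shows "inv x \<otimes> (x \<otimes> y) = y" "x \<otimes> (inv x \<otimes> y) = y"
  using assms by (simp_all flip: m_assoc)

lemma conj_by_closed: "g \<in> carrier G \<Longrightarrow> x \<in> carrier G \<Longrightarrow> conj_by G g x \<in> carrier G"
  by (simp add: conj_by_def)

lemma conj_by_one: "x \<in> carrier G \<Longrightarrow> conj_by G \<one> x = x"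
  by (simp add: conj_by_def)

lemma conj_by_mult:
  "g \<in> carrier G \<Longrightarrow> h \<in> carrier G \<Longrightarrow> x \<in> carrier G \<Longrightarrow>
    conj_by G (g \<otimes> h) x = conj_by G g (conj_by G h x)"
  by (simp add: conj_by_def inv_mult_group m_assoc)

lemma conj_by_hom: "g \<in> carrier G \<Longrightarrow> conj_by G g \<in> hom G G"
  by (rule homI) (simp_all add: conj_by_def m_assoc inv_mult_cancel)

lemma conj_by_group_hom: "g \<in> carrier G \<Longrightarrow> group_hom G G (conj_by G g)"
  by (intro group_hom.intro group_hom_axioms.intro is_group conj_by_hom)

lemma conj_by_mult_right:
  "g \<in> carrier G \<Longrightarrow> x \<in> carrier G \<Longrightarrow> conj_by G g x \<otimes> g = g \<otimes> x"
  by (simp add: conj_by_def m_assoc)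

lemma conj_by_eqI:
  "g \<in> carrier G \<Longrightarrow> x \<in> carrier G \<Longrightarrow> y \<in> carrier G \<Longrightarrow> y \<otimes> g = g \<otimes> x \<Longrightarrow> conj_by G g x = y"
  unfolding conj_by_def by (metis m_closed inv_solve_right)

end

lemma (in group_hom) hom_conj_by:
  "g \<in> carrier G \<Longrightarrow> x \<in> carrier G \<Longrightarrow> h (conj_by G g x) = conj_by H (h g) (h x)"
  by (simp add: conj_by_def)

lemma (in group) group_conj_involution:
  assumes "s \<in> carrier G" "s \<otimes> s = \<one>"
  shows "group_conj G x s = conj_by G s x"
  using assms by (simp add: group_conj_def conj_by_def inv_equality)

text \<open>This translates the relations of \<open>y(m)\<close> into those of \<open>Y(m)\<close>. With \<open>t = x\<^sup>-\<^sup>1 s x\<close>, the two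
  involutions \<open>s\<close> and \<open>t\<close> commute if and only if \<open>(t s)\<^sup>2 = 1\<close>, and \<open>t s = x\<^sup>-\<^sup>1 (s x s)\<close>. For \<open>x\<close> a
  power of \<open>a\<close>, this is a product of powers of two conjugates of \<open>a\<close>.\<close>

lemma (in group) involution_commutes_with_conjugate_iff:
  assumes s: "s \<in> carrier G" "s \<otimes> s = \<one>" and x: "x \<in> carrier G"
  shows "group_comm G s (group_conj G s x) = \<one> \<longleftrightarrow> (inv x \<otimes> conj_by G s x) [^] (2::nat) = \<one>"
proof -
  have inv_s: "inv s = s" using s by (simp add: inv_equality)
  define t where "t = group_conj G s x"
  have t: "t \<in> carrier G" using s x by (simp add: t_def group_conj_closed is_group)
  have inv_t: "inv t = t" using s x by (simp add: t_def group_conj_def inv_mult_group m_assoc inv_s)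
  have "inv x \<otimes> conj_by G s x = t \<otimes> s"
    using s x by (simp add: t_def group_conj_def conj_by_def inv_s m_assoc)
  then have "(inv x \<otimes> conj_by G s x) [^] (2::nat) = t \<otimes> s \<otimes> (t \<otimes> s)"
    using s t by (simp add: numeral_2_eq_2)
  moreover have "group_comm G s t = inv (t \<otimes> s \<otimes> (t \<otimes> s))"
    using s t by (simp add: group_comm_def inv_mult_group inv_s inv_t m_assoc)
  ultimately show ?thesis
    using s t by (simp add: t_def[symmetric] inv_eq_1_iff)
qed

section \<open>Homomorphisms from a semidirect product\<close>

locale group_action_by_autos = N: group N + H: group H
  for N :: "('a, 'c) monoid_scheme" and H :: "('b, 'd) monoid_scheme" +
  fixes \<phi> :: "'b \<Rightarrow> 'a \<Rightarrow> 'a"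
  assumes action: "\<phi> \<in> hom H (AutoGroup N)"
begin

abbreviation P where "P \<equiv> semidirect_product N H \<phi>"

sublocale P: group P
  by (rule group_semidirect_product[OF N.is_group H.is_group action])

lemma carrier_P: "carrier P = carrier N \<times> carrier H"
  by (simp add: semidirect_product_def)

lemma mult_P: "(n, h) \<otimes>\<^bsub>P\<^esub> (n', h') = (n \<otimes>\<^bsub>N\<^esub> \<phi> h n', h \<otimes>\<^bsub>H\<^esub> h')"
  by (simp add: semidirect_product_def)

lemma one_P: "\<one>\<^bsub>P\<^esub> = (\<one>\<^bsub>N\<^esub>, \<one>\<^bsub>H\<^esub>)"
  by (simp add: semidirect_product_def)

lemma action_hom: "h \<in> carrier H \<Longrightarrow> \<phi> h \<in> hom N N"
  using hom_in_carrier[OF action] by (auto simp: AutoGroup_def auto_def)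

lemma action_group_hom: "h \<in> carrier H \<Longrightarrow> group_hom N N (\<phi> h)"
  by (intro group_hom.intro group_hom_axioms.intro N.is_group action_hom)

lemma action_closed: "h \<in> carrier H \<Longrightarrow> n \<in> carrier N \<Longrightarrow> \<phi> h n \<in> carrier N"
  using action_hom hom_in_carrier by metis

lemma action_one: "n \<in> carrier N \<Longrightarrow> \<phi> \<one>\<^bsub>H\<^esub> n = n"
  using hom_one[OF action H.is_group N.AutoGroup] by (simp add: AutoGroup_def BijGroup_def)

lemma inl_hom: "(\<lambda>n. (n, \<one>\<^bsub>H\<^esub>)) \<in> hom N P"
  by (rule homI) (simp_all add: carrier_P mult_P action_one)

lemma inr_hom: "(\<lambda>h. (\<one>\<^bsub>N\<^esub>, h)) \<in> hom H P"
  by (rule homI) (simp_all add: carrier_P mult_P hom_one[OF action_hom N.is_group N.is_group])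

lemma inl_group_hom: "group_hom N P (\<lambda>n. (n, \<one>\<^bsub>H\<^esub>))"
  by (intro group_hom.intro group_hom_axioms.intro N.is_group P.is_group inl_hom)

lemma decompose: "n \<in> carrier N \<Longrightarrow> h \<in> carrier H \<Longrightarrow> (n, h) = (n, \<one>\<^bsub>H\<^esub>) \<otimes>\<^bsub>P\<^esub> (\<one>\<^bsub>N\<^esub>, h)"
  by (simp add: mult_P action_one)

lemma conj_by_inr:
  assumes "n \<in> carrier N" "h \<in> carrier H"
  shows "conj_by P (\<one>\<^bsub>N\<^esub>, h) (n, \<one>\<^bsub>H\<^esub>) = (\<phi> h n, \<one>\<^bsub>H\<^esub>)"
  by (rule P.conj_by_eqI)
    (use assms in \<open>simp_all add: carrier_P mult_P action_closed hom_one[OF action_hom N.is_group N.is_group]\<close>)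

lemma conj_by_P:
  assumes n: "n \<in> carrier N" and h: "h \<in> carrier H" and x: "x \<in> carrier N"
  shows "conj_by P (n, h) (x, \<one>\<^bsub>H\<^esub>) = (conj_by N n (\<phi> h x), \<one>\<^bsub>H\<^esub>)"
proof -
  interpret inl: group_hom N P "\<lambda>n. (n, \<one>\<^bsub>H\<^esub>)" by (rule inl_group_hom)
  have "conj_by P (n, h) (x, \<one>\<^bsub>H\<^esub>) = conj_by P (n, \<one>\<^bsub>H\<^esub>) (\<phi> h x, \<one>\<^bsub>H\<^esub>)"
    by (subst decompose[OF n h]) (use assms in \<open>simp add: P.conj_by_mult carrier_P conj_by_inr\<close>)
  then show ?thesis using assms by (simp add: inl.hom_conj_by action_closed)
qed

text \<open>The universal property: a homomorphism on each factor extends to the whole group as soon as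
  conjugation in the target realises the action.\<close>

lemma P_homI:
  assumes K: "group K" and f: "f \<in> hom N K" and g: "g \<in> hom H K"
    and compat: "\<And>h n. h \<in> carrier H \<Longrightarrow> n \<in> carrier N \<Longrightarrow> conj_by K (g h) (f n) = f (\<phi> h n)"
  shows "(\<lambda>(n, h). f n \<otimes>\<^bsub>K\<^esub> g h) \<in> hom P K"
proof (rule homI)
  interpret K: group K by fact
  have fc: "f n \<in> carrier K" if "n \<in> carrier N" for n using hom_in_carrier[OF f that] .
  have gc: "g h \<in> carrier K" if "h \<in> carrier H" for h using hom_in_carrier[OF g that] .
  fix x y assume "x \<in> carrier P" "y \<in> carrier P"
  then obtain n h n' h' where x: "x = (n, h)" "n \<in> carrier N" "h \<in> carrier H"
    and y: "y = (n', h')" "n' \<in> carrier N" "h' \<in> carrier H" by (auto simp: carrier_P)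
  have "f (\<phi> h n') \<otimes>\<^bsub>K\<^esub> g h = g h \<otimes>\<^bsub>K\<^esub> f n'"
    using K.conj_by_mult_right[of "g h" "f n'"] x y by (simp add: compat fc gc)
  then have "f (\<phi> h n') \<otimes>\<^bsub>K\<^esub> (g h \<otimes>\<^bsub>K\<^esub> g h') = g h \<otimes>\<^bsub>K\<^esub> (f n' \<otimes>\<^bsub>K\<^esub> g h')"
    using x y by (simp add: fc gc action_closed flip: K.m_assoc)
  then show "(case x \<otimes>\<^bsub>P\<^esub> y of (n, h) \<Rightarrow> f n \<otimes>\<^bsub>K\<^esub> g h) =
      (case x of (n, h) \<Rightarrow> f n \<otimes>\<^bsub>K\<^esub> g h) \<otimes>\<^bsub>K\<^esub> (case y of (n, h) \<Rightarrow> f n \<otimes>\<^bsub>K\<^esub> g h)"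
    using x y by (simp add: mult_P hom_mult[OF f] hom_mult[OF g] action_closed fc gc K.m_assoc)
next
  interpret K: group K by fact
  fix x assume "x \<in> carrier P"
  then show "(case x of (n, h) \<Rightarrow> f n \<otimes>\<^bsub>K\<^esub> g h) \<in> carrier K"
    using hom_in_carrier[OF f] hom_in_carrier[OF g] by (auto simp: carrier_P)
qed

lemma P_hom_eqI:
  assumes f: "f \<in> hom P K" and g: "g \<in> hom P K"
    and "\<And>n. n \<in> carrier N \<Longrightarrow> f (n, \<one>\<^bsub>H\<^esub>) = g (n, \<one>\<^bsub>H\<^esub>)"
    and "\<And>h. h \<in> carrier H \<Longrightarrow> f (\<one>\<^bsub>N\<^esub>, h) = g (\<one>\<^bsub>N\<^esub>, h)"
    and x: "x \<in> carrier P"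
  shows "f x = g x"
proof -
  obtain n h where x: "x = (n, h)" "n \<in> carrier N" "h \<in> carrier H" using x by (auto simp: carrier_P)
  show ?thesis
    unfolding x(1) by (subst (1 2) decompose)
      (use assms x in \<open>simp_all add: hom_mult[OF f] hom_mult[OF g] carrier_P\<close>)
qed

end

section \<open>The symmetric group and the point 1\<close>

text \<open>Adjacent transpositions yield all transpositions, by \<open>(i, k + 1) = (k, k + 1) (i, k) (k, k + 1)\<close>
  and induction on the distance, and transpositions generate the symmetric group.\<close>

lemma adjacent_transpositions_generate_interval:
  assumes K: "subgroup C (sym_group m)"
    and adj: "\<And>i. l \<le> i \<Longrightarrow> i \<le> m - 1 \<Longrightarrow> transpose i (i + 1) \<in> C"
    and \<sigma>: "\<sigma> permutes {l..m}" and l: "1 \<le> l"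
  shows "\<sigma> \<in> C"
proof -
  have comp: "p \<circ> q \<in> C" if "p \<in> C" "q \<in> C" for p q
    using subgroup.m_closed[OF K that] by (simp add: sym_group_mult)
  have less: "transpose i j \<in> C" if "l \<le> i" "i < j" "j \<le> m" for i j
    using that(2,3)
  proof (induction j rule: less_induct)
    case (less j)
    show ?case
    proof (cases "j = i + 1")
      case True
      then show ?thesis using adj[of i] less that by auto
    next
      case False
      define k where "k = j - 1"
      have k: "j = k + 1" "i < k" "k \<le> m - 1" using False less by (auto simp: k_def)
      have "transpose k (k + 1) \<circ> (transpose i k \<circ> transpose k (k + 1)) \<in> C"
        using k that less by (intro comp adj less.IH) auto
      moreover have "transpose k (k + 1) \<circ> (transpose i k \<circ> transpose k (k + 1)) = transpose i j"
        using k by (auto simp: fun_eq_iff transpose_def)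
      ultimately show ?thesis by simp
    qed
  qed
  then have swap: "transpose i j \<in> C" if "i \<in> {l..m}" "j \<in> {l..m}" "i \<noteq> j" for i j
    using that less[of i j] less[of j i] by (cases "i < j") (auto simp: transpose_commute)
  have "id \<in> C" using subgroup.one_closed[OF K] by (simp add: sym_group_one)
  then show ?thesis
    by (rule permutes_induct[OF \<sigma> finite_atLeastAtMost, where P = "\<lambda>\<sigma>. \<sigma> \<in> C"]) (blast intro: comp swap)+
qed

lemma permutes_fixing_first:
  fixes \<sigma> :: "nat \<Rightarrow> nat"
  assumes "\<sigma> permutes {1..m}" "\<sigma> 1 = 1"
  shows "\<sigma> permutes {2..m}"
  by (rule permutes_superset[OF assms(1)]) (use assms(2) in \<open>auto simp: not_le numeral_2_eq_2 less_Suc_eq_le\<close>)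

lemma two_transitive:
  assumes "i \<in> {1..m}" "j \<in> {1..m}" "i \<noteq> j"
  obtains \<sigma> where "\<sigma> \<in> carrier (sym_group m)" "\<sigma> 1 = i" "\<sigma> 2 = j"
proof
  let ?x = "transpose 1 i j"
  have m: "m \<ge> 2" using assms by auto
  have "?x \<in> {1..m}" "?x \<noteq> 1" using assms by (auto simp: transpose_def)
  then show "transpose 1 i \<circ> transpose 2 ?x \<in> carrier (sym_group m)"
    "(transpose 1 i \<circ> transpose 2 ?x) 1 = i" "(transpose 1 i \<circ> transpose 2 ?x) 2 = j"
    using m assms by (auto simp: sym_group_carrier intro!: permutes_compose permutes_swap_id simp: transpose_def)
qed

text \<open>The sign, with values in the additive group \<open>C\<^sub>2\<close> whose generator is \<open>\<tau>\<close>.\<close>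

definition parity :: "(nat \<Rightarrow> nat) \<Rightarrow> int" where
  "parity \<sigma> = (if evenperm \<sigma> then 0 else 1)"

lemma parity_hom: "parity \<in> hom (sym_group m) (integer_mod_group 2)"
  by (rule homI)
    (auto simp: parity_def sym_group_mult carrier_integer_mod_group evenperm_comp dest!: sym_group_carrier')

section \<open>Extending a twisted action to \<open>Y(m)\<close>\<close>

text \<open>The elements of \<open>S\<^sub>m\<close> that act trivially on \<open>a\<close> form a subgroup, and the adjacent transpositions
  in it generate the stabiliser of 1.\<close>

lemma centralised_by_point_stabiliser:
  assumes K: "group K" and S: "S \<in> hom (sym_group m) K" and a: "a \<in> carrier K"
    and adj: "\<And>i. 2 \<le> i \<Longrightarrow> i \<le> m - 1 \<Longrightarrow> conj_by K (S (transpose i (i + 1))) a = a"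
    and \<sigma>: "\<sigma> \<in> carrier (sym_group m)" "\<sigma> 1 = 1"
  shows "conj_by K (S \<sigma>) a = a"
proof -
  interpret K: group K by fact
  interpret G: group "sym_group m" by (rule sym_group_is_group)
  interpret S: group_hom "sym_group m" K S
    by (intro group_hom.intro group_hom_axioms.intro G.is_group K S)
  define C where "C = {\<sigma> \<in> carrier (sym_group m). conj_by K (S \<sigma>) a = a}"
  have "subgroup C (sym_group m)"
  proof (rule G.subgroupI)
    show "C \<noteq> {}" using a K.conj_by_one[OF a] by (auto simp: C_def intro!: exI[of _ "\<one>\<^bsub>sym_group m\<^esub>"])
    fix \<sigma> assume s: "\<sigma> \<in> C"
    then have "\<sigma> \<in> carrier (sym_group m)" by (simp add: C_def)
    then have "conj_by K (inv\<^bsub>K\<^esub> (S \<sigma>)) (conj_by K (S \<sigma>) a) = a"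
      using a by (simp add: K.conj_by_one flip: K.conj_by_mult)
    then show "inv\<^bsub>sym_group m\<^esub> \<sigma> \<in> C"
      using s by (simp add: C_def del: sym_group_inv_equality)
  next
    fix \<sigma> \<rho> assume "\<sigma> \<in> C" "\<rho> \<in> C"
    then show "\<sigma> \<otimes>\<^bsub>sym_group m\<^esub> \<rho> \<in> C" using a by (simp add: C_def K.conj_by_mult)
  qed (auto simp: C_def)
  then have "\<sigma> \<in> C"
  proof (rule adjacent_transpositions_generate_interval[where l = 2])
    show "transpose i (i + 1) \<in> C" if "2 \<le> i" "i \<le> m - 1" for i
      using that adj[OF that] adj_transpose_closed[of i m] by (auto simp: C_def)
    show "\<sigma> permutes {2..m}" using \<sigma> by (intro permutes_fixing_first) (auto simp: sym_group_carrier)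
  qed auto
  then show ?thesis by (simp add: C_def)
qed

text \<open>To map \<open>Y(m)\<close> into a group \<open>K\<close> on which \<open>S\<^sub>m\<close> acts by inner automorphisms, it suffices to give the
  image \<open>a\<close> of \<open>a\<^sub>1\<close>. The image of \<open>a\<^sub>i\<close> must be a conjugate of \<open>a\<close> by some \<open>\<sigma>\<close> with \<open>\<sigma> 1 = i\<close>,
  which is well defined because the stabiliser of 1 fixes \<open>a\<close>. A pair \<open>i \<noteq> j\<close> is the image of
  \<open>(1, 2)\<close> under some permutation, so every relation of \<open>Y(m)\<close> is conjugate to the one for
  \<open>a\<^sub>1\<close> and \<open>a\<^sub>2\<close>.\<close>

lemma Y_group_universal_conjugates:
  assumes m: "m \<ge> 2" and K: "group K" and S: "S \<in> hom (sym_group m) K" and a: "a \<in> carrier K"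
    and adj: "\<And>i. 2 \<le> i \<Longrightarrow> i \<le> m - 1 \<Longrightarrow> conj_by K (S (transpose i (i + 1))) a = a"
    and rel: "\<And>k::int. (a [^]\<^bsub>K\<^esub> k \<otimes>\<^bsub>K\<^esub> conj_by K (S (transpose 1 2)) (a [^]\<^bsub>K\<^esub> k)) [^]\<^bsub>K\<^esub> (2::nat) = \<one>\<^bsub>K\<^esub>"
  obtains f where "f \<in> hom (Y_group m) K"
    "\<And>\<sigma>. \<sigma> \<in> carrier (sym_group m) \<Longrightarrow> f (Y_gen m (\<sigma> 1)) = conj_by K (S \<sigma>) a"
proof -
  interpret K: group K by fact
  interpret G: group "sym_group m" by (rule sym_group_is_group)
  interpret S: group_hom "sym_group m" K S
    by (intro group_hom.intro group_hom_axioms.intro G.is_group K S)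
  have well: "conj_by K (S \<sigma>) a = conj_by K (S \<rho>) a"
    if \<sigma>: "\<sigma> \<in> carrier (sym_group m)" and \<rho>: "\<rho> \<in> carrier (sym_group m)" and eq: "\<sigma> 1 = \<rho> 1" for \<sigma> \<rho>
  proof -
    let ?d = "inv\<^bsub>sym_group m\<^esub> \<rho> \<otimes>\<^bsub>sym_group m\<^esub> \<sigma>"
    have "inv' \<rho> (\<rho> 1) = 1" using \<rho> permutes_inverses(2) by (metis sym_group_carrier)
    then have "?d 1 = 1" using \<rho> by (simp add: sym_group_mult eq del: One_nat_def)
    then have "conj_by K (S ?d) a = a"
      using \<sigma> \<rho> by (intro centralised_by_point_stabiliser[OF K S a adj])
        (auto simp del: sym_group_inv_equality)
    then have "conj_by K (S \<rho>) (conj_by K (S ?d) a) = conj_by K (S \<rho>) a" by simp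
    moreover have "\<rho> \<otimes>\<^bsub>sym_group m\<^esub> ?d = \<sigma>"
      using \<sigma> \<rho> by (simp add: G.inv_mult_cancel del: sym_group_inv_equality)
    ultimately show ?thesis
      using \<sigma> \<rho> a by (simp flip: K.conj_by_mult S.hom_mult del: sym_group_inv_equality)
  qed
  \<comment> \<open>\<open>transpose 1 i\<close> is merely a convenient representative of the permutations that take 1 to \<open>i\<close>.\<close>
  define f where "f i = conj_by K (S (transpose 1 i)) a" for i
  have tr: "transpose 1 i \<in> carrier (sym_group m)" if "i \<in> {1..m}" for i
    using that by (simp add: sym_group_carrier permutes_swap_id)
  have f: "f (\<sigma> 1) = conj_by K (S \<sigma>) a" if "\<sigma> \<in> carrier (sym_group m)" for \<sigma>
  proof -
    have "\<sigma> 1 \<in> {1..m}" using that m permutes_in_image[of \<sigma> "{1..m}" 1] by (simp add: sym_group_carrier)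
    then show ?thesis unfolding f_def by (intro well tr that) auto
  qed
  have s: "transpose 1 2 \<in> carrier (sym_group m)" using tr[of 2] m by simp
  have rels: "(f i [^]\<^bsub>K\<^esub> k \<otimes>\<^bsub>K\<^esub> f j [^]\<^bsub>K\<^esub> k) [^]\<^bsub>K\<^esub> (2::nat) = \<one>\<^bsub>K\<^esub>"
    if ij: "i \<in> {1..m}" "j \<in> {1..m}" "i \<noteq> j" for i j and k :: int
  proof -
    obtain \<sigma> where \<sigma>: "\<sigma> \<in> carrier (sym_group m)" "\<sigma> 1 = i" "\<sigma> 2 = j"
      using two_transitive[OF ij] .
    interpret c: group_hom K K "conj_by K (S \<sigma>)" using \<sigma> by (intro K.conj_by_group_hom) simp
    let ?b = "conj_by K (S (transpose 1 2))"
    interpret b: group_hom K K ?b using s by (intro K.conj_by_group_hom) simp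
    have fi: "f i = conj_by K (S \<sigma>) a" using f[of \<sigma>] \<sigma> by simp
    have fj: "f j = conj_by K (S \<sigma>) (?b a)"
      using f[OF G.m_closed[OF \<sigma>(1) s]] \<sigma> s a
      by (simp add: K.conj_by_mult del: One_nat_def) (simp add: sym_group_mult)
    have "(f i [^]\<^bsub>K\<^esub> k \<otimes>\<^bsub>K\<^esub> f j [^]\<^bsub>K\<^esub> k) [^]\<^bsub>K\<^esub> (2::nat)
        = conj_by K (S \<sigma>) ((a [^]\<^bsub>K\<^esub> k \<otimes>\<^bsub>K\<^esub> ?b (a [^]\<^bsub>K\<^esub> k)) [^]\<^bsub>K\<^esub> (2::nat))"
      using \<sigma> s a by (simp add: fi fj c.hom_nat_pow c.hom_int_pow b.hom_int_pow K.conj_by_closed del: One_nat_def)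
    then show ?thesis unfolding rel by simp
  qed
  have "f \<in> {1..m} \<rightarrow> carrier K" using tr a by (auto simp: f_def intro!: K.conj_by_closed)
  from Y_group_universal[OF K this rels] obtain h
    where "h \<in> hom (Y_group m) K" "\<And>i. i \<in> {1..m} \<Longrightarrow> h (Y_gen m i) = f i" by metis
  moreover have "\<sigma> 1 \<in> {1..m}" if "\<sigma> \<in> carrier (sym_group m)" for \<sigma>
    using that m permutes_in_image[of \<sigma> "{1..m}" 1] by (simp add: sym_group_carrier)
  ultimately show ?thesis using that f by metis
qed


section \<open>The two homomorphisms\<close>

lemma transpose_involution:
  "transpose i j \<otimes>\<^bsub>sym_group m\<^esub> transpose i j = \<one>\<^bsub>sym_group m\<^esub>"
  by (simp add: sym_group_mult sym_group_one)

lemma carrier_C2: "c \<in> carrier (integer_mod_group 2) \<longleftrightarrow> c = 0 \<or> c = 1"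
  by (auto simp: carrier_integer_mod_group)

lemma parity_closed: "parity \<sigma> \<in> carrier (integer_mod_group 2)"
  by (simp add: parity_def carrier_C2)

lemma parity_adj: "parity (transpose i (i + 1)) = 1"
  by (simp add: parity_def evenperm_swap)

context
  fixes m :: nat
  assumes m: "m \<ge> 2"
begin

interpretation y: group "y_group m" by (rule group_y_group[OF m])

interpretation Y: group "Y_group m" by (rule group_Y_group)

interpretation C: group "integer_mod_group 2" by (rule group_integer_mod_group)

interpretation S: group "sym_group m" by (rule sym_group_is_group)

interpretation T: group_action_by_autos "y_group m" "integer_mod_group 2" "tau_action m"
  by (intro group_action_by_autos.intro group_action_by_autos_axioms.intro tau_action_hom[OF m])
    unfold_locales

interpretation Q: group_action_by_autos "Y_group m" "sym_group m \<times>\<times> integer_mod_group 2" "Y_action m"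
  by (intro group_action_by_autos.intro group_action_by_autos_axioms.intro Y_action_hom
      DirProd_group S.is_group C.is_group Y.is_group)

interpretation perm: group_hom "sym_group m" "y_group m" "y_perm m"
  by (intro group_hom.intro group_hom_axioms.intro y_perm_hom[OF m]) unfold_locales

lemma tau_action_gen:
  "c \<in> carrier (integer_mod_group 2) \<Longrightarrow>
    tau_action m c (y_gen m) = (if c = 0 then y_gen m else inv\<^bsub>y_group m\<^esub> (y_gen m))"
  using m by (simp add: tau_action_def tau_auto_gen AutoGroup_def BijGroup_def y_gen_closed)

lemma tau_action_perm:
  "\<sigma> \<in> carrier (sym_group m) \<Longrightarrow> tau_action m c (y_perm m \<sigma>) = y_perm m \<sigma>"
  using m by (simp add: tau_action_def tau_auto_perm AutoGroup_def BijGroup_def)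

lemma transpose_12: "transpose 1 2 \<in> carrier (sym_group m)"
  using adj_transpose_closed[of 1 m] m by (simp add: numeral_2_eq_2)

text \<open>The image \<open>(\<sigma>, parity \<sigma>)\<close> of \<open>\<sigma>\<close> undoes the twist: it acts on \<open>a\<^sub>1\<close> as \<open>\<sigma>\<close> followed by inversion if
  \<open>\<sigma>\<close> is odd. Hence \<open>s\<^sub>i\<close> inverts \<open>a\<^sub>1\<close> for \<open>i \<ge> 2\<close>, and \<open>s\<^sub>1\<close> takes it to the inverse of
  \<open>a\<^sub>2\<close>, which makes the commutator relation the relation of \<open>Y(m)\<close> between \<open>a\<^sub>1\<close> and \<open>a\<^sub>2\<close>.\<close>

lemma ytilde_to_semidirect:
  obtains F where "F \<in> hom T.P Q.P"
    "F (y_gen m, 0) = (Y_gen m 1, (id, 0))"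
    "\<And>\<sigma> c. \<sigma> \<in> carrier (sym_group m) \<Longrightarrow> c \<in> carrier (integer_mod_group 2) \<Longrightarrow>
      F (y_perm m \<sigma>, c) = (\<one>\<^bsub>Y_group m\<^esub>, (\<sigma>, (parity \<sigma> + c) mod 2))"
proof -
  let ?Q = Q.P and ?Y = "Y_group m"
  have one: "\<one>\<^bsub>sym_group m \<times>\<times> integer_mod_group 2\<^esub> = (id, 0)"
    by (simp add: sym_group_one)
  have inl: "group_hom ?Y ?Q (\<lambda>n. (n, (id, 0)))" using Q.inl_group_hom unfolding one .
  have id: "id \<in> carrier (sym_group m)" using S.one_closed by (simp add: sym_group_one)
  define a where "a = (Y_gen m 1, (id :: nat \<Rightarrow> nat, 0 :: int))"
  define q where "q \<sigma> = (\<one>\<^bsub>?Y\<^esub>, (\<sigma>, parity \<sigma>))" for \<sigma> :: "nat \<Rightarrow> nat"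
  have Yg: "Y_gen m 1 \<in> carrier ?Y" "Y_gen m 2 \<in> carrier ?Y" using m by (simp_all add: Y_gen_closed)
  have a: "a \<in> carrier ?Q" using Yg id by (simp add: a_def Q.carrier_P carrier_C2 del: One_nat_def)
  have "(\<lambda>\<sigma>. (\<sigma>, parity \<sigma>)) \<in> hom (sym_group m) (sym_group m \<times>\<times> integer_mod_group 2)"
    by (rule homI) (simp_all add: parity_closed hom_mult[OF parity_hom])
  from Group.hom_compose[OF this Q.inr_hom] have q: "q \<in> hom (sym_group m) ?Q"
    by (simp add: o_def q_def[abs_def])
  interpret q: group_hom "sym_group m" ?Q q
    by (intro group_hom.intro group_hom_axioms.intro q) unfold_locales
  have invol: "q (transpose i j) \<otimes>\<^bsub>?Q\<^esub> q (transpose i j) = \<one>\<^bsub>?Q\<^esub>"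
    if "transpose i j \<in> carrier (sym_group m)" for i j
    using q.hom_mult[OF that that] by (simp add: transpose_involution)
  have conj_q: "conj_by ?Q (q \<sigma>) (n, (id, 0)) = (Y_action m (\<sigma>, parity \<sigma>) n, (id, 0))"
    if "\<sigma> \<in> carrier (sym_group m)" "n \<in> carrier ?Y" for \<sigma> n
    using Q.conj_by_inr[of n "(\<sigma>, parity \<sigma>)"] that by (simp add: q_def parity_closed sym_group_one)
  have comm: "group_comm ?Q (q (transpose 1 2)) (group_conj ?Q (q (transpose 1 2)) (a [^]\<^bsub>?Q\<^esub> k)) = \<one>\<^bsub>?Q\<^esub>"
    for k :: int
  proof -
    interpret c: group_hom ?Q ?Q "conj_by ?Q (q (transpose 1 2))"
      using transpose_12 by (intro Q.P.conj_by_group_hom) simp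
    have "parity (transpose 1 2) = 1" using parity_adj[of 1] by (simp add: numeral_2_eq_2)
    then have conj_a: "conj_by ?Q (q (transpose 1 2)) a = (inv\<^bsub>?Y\<^esub> (Y_gen m 2), (id, 0))"
      using conj_q[OF transpose_12 Yg(1)] Y_action_gen[OF transpose_12, of 1 1] m
      by (simp add: a_def)
    have "inv\<^bsub>?Q\<^esub> (a [^]\<^bsub>?Q\<^esub> k) \<otimes>\<^bsub>?Q\<^esub> conj_by ?Q (q (transpose 1 2)) (a [^]\<^bsub>?Q\<^esub> k)
        = (Y_gen m 1 [^]\<^bsub>?Y\<^esub> (-k) \<otimes>\<^bsub>?Y\<^esub> Y_gen m 2 [^]\<^bsub>?Y\<^esub> (-k), (id, 0))"
    proof -
      have ak: "a [^]\<^bsub>?Q\<^esub> k = (Y_gen m 1 [^]\<^bsub>?Y\<^esub> k, (id, 0))"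
        using group_hom.hom_int_pow[OF inl Yg(1)] by (simp add: a_def)
      have "conj_by ?Q (q (transpose 1 2)) (a [^]\<^bsub>?Q\<^esub> k) = (Y_gen m 2 [^]\<^bsub>?Y\<^esub> (-k), (id, 0))"
        using c.hom_int_pow[OF a, of k] group_hom.hom_int_pow[OF inl Y.inv_closed[OF Yg(2)], of k] Yg
        by (simp add: conj_a Y.int_pow_inv Y.int_pow_neg del: One_nat_def)
      moreover have "inv\<^bsub>?Q\<^esub> (a [^]\<^bsub>?Q\<^esub> k) = (Y_gen m 1 [^]\<^bsub>?Y\<^esub> (-k), (id, 0))"
        using group_hom.hom_inv[OF inl Y.int_pow_closed[OF Yg(1)], of k] Yg by (simp add: ak Y.int_pow_neg)
      ultimately show ?thesis
        using group_hom.hom_mult[OF inl Y.int_pow_closed[OF Yg(1)] Y.int_pow_closed[OF Yg(2)]] by simp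
    qed
    then have "(inv\<^bsub>?Q\<^esub> (a [^]\<^bsub>?Q\<^esub> k) \<otimes>\<^bsub>?Q\<^esub> conj_by ?Q (q (transpose 1 2)) (a [^]\<^bsub>?Q\<^esub> k)) [^]\<^bsub>?Q\<^esub> (2::nat)
        = ((Y_gen m 1 [^]\<^bsub>?Y\<^esub> (-k) \<otimes>\<^bsub>?Y\<^esub> Y_gen m 2 [^]\<^bsub>?Y\<^esub> (-k)) [^]\<^bsub>?Y\<^esub> (2::nat), (id, 0))"
      using Yg by (simp add: group_hom.hom_nat_pow[OF inl, symmetric])
    also have "\<dots> = \<one>\<^bsub>?Q\<^esub>"
      using Y_gen_relation[of 1 m 2 "-k"] m by (simp add: Q.one_P sym_group_one)
    finally show ?thesis
      using Q.P.involution_commutes_with_conjugate_iff[OF q.hom_closed[OF transpose_12] invol[OF transpose_12]] a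
      by simp
  qed
  have inv: "group_conj ?Q a (q (transpose i (i + 1))) = inv\<^bsub>?Q\<^esub> a" if i: "2 \<le> i" "i \<le> m - 1" for i
  proof -
    have t: "transpose i (i + 1) \<in> carrier (sym_group m)"
      by (rule adj_transpose_closed) (use i m in auto)
    have "transpose i (i + 1) 1 = 1" using i by (auto simp: transpose_def)
    then have "conj_by ?Q (q (transpose i (i + 1))) a = (inv\<^bsub>?Y\<^esub> (Y_gen m 1), (id, 0))"
      using conj_q[OF t Yg(1)] Y_action_gen[OF t, of 1 1] m parity_adj[of i] by (simp add: a_def)
    then show ?thesis
      using Q.P.group_conj_involution[OF q.hom_closed[OF t] invol[OF t], of a] group_hom.hom_inv[OF inl Yg(1)]
      by (simp add: a_def)
  qed
  obtain f where f: "f \<in> hom (y_group m) ?Q" "f (y_gen m) = a"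
    "\<And>\<sigma>. \<sigma> \<in> carrier (sym_group m) \<Longrightarrow> f (y_perm m \<sigma>) = q \<sigma>"
    using y_group_universal[OF m Q.P.is_group a q comm inv] by blast
  interpret f: group_hom "y_group m" ?Q f
    by (intro group_hom.intro group_hom_axioms.intro f) unfold_locales
  define g where "g c = (\<one>\<^bsub>?Y\<^esub>, (id :: nat \<Rightarrow> nat, c))" for c :: int
  have "(\<lambda>c. (id, c)) \<in> hom (integer_mod_group 2) (sym_group m \<times>\<times> integer_mod_group 2)"
    by (rule homI) (simp_all add: id sym_group_mult)
  from Group.hom_compose[OF this Q.inr_hom] have g: "g \<in> hom (integer_mod_group 2) ?Q"
    by (simp add: o_def g_def[abs_def])
  \<comment> \<open>Both sides are homomorphisms in \<open>x\<close>, so it suffices to compare them on \<open>a\<close> and on \<open>S\<^sub>m\<close>.\<close>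
  have compat: "conj_by ?Q (g c) (f x) = f (tau_action m c x)"
    if c: "c \<in> carrier (integer_mod_group 2)" and x: "x \<in> carrier (y_group m)" for c x
  proof (rule y_group_hom_eqI[OF m Q.P.is_group _ _ _ _ x, where h = "\<lambda>x. conj_by ?Q (g c) (f x)"])
    have gc: "g c \<in> carrier ?Q" using hom_in_carrier[OF g c] .
    show "(\<lambda>x. conj_by ?Q (g c) (f x)) \<in> hom (y_group m) ?Q"
      using Group.hom_compose[OF f(1) Q.P.conj_by_hom[OF gc]] by (simp add: o_def)
    show "(\<lambda>x. f (tau_action m c x)) \<in> hom (y_group m) ?Q"
      using Group.hom_compose[OF T.action_hom[OF c] f(1)] by (simp add: o_def)
    have "conj_by ?Q (g c) a = (Y_action m (id, c) (Y_gen m 1), (id, 0))"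
      using Q.conj_by_inr[of "Y_gen m 1" "(id, c)"] Yg id c by (simp add: a_def g_def sym_group_one)
    then show "conj_by ?Q (g c) (f (y_gen m)) = f (tau_action m c (y_gen m))"
      using Y_action_gen[OF id, of 1 c] m c group_hom.hom_inv[OF inl Yg(1)]
      by (simp add: tau_action_gen f y_gen_closed) (simp add: a_def)
    fix \<sigma> assume \<sigma>: "\<sigma> \<in> carrier (sym_group m)"
    have "q \<sigma> \<otimes>\<^bsub>?Q\<^esub> g c = g c \<otimes>\<^bsub>?Q\<^esub> q \<sigma>"
      using \<sigma> id c parity_closed[of \<sigma>]
      by (simp add: q_def g_def Q.mult_P hom_one[OF Q.action_hom Y.is_group Y.is_group] sym_group_mult add.commute)
    then show "conj_by ?Q (g c) (f (y_perm m \<sigma>)) = f (tau_action m c (y_perm m \<sigma>))"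
      using \<sigma> gc by (simp add: tau_action_perm f Q.P.conj_by_eqI)
  qed
  show ?thesis
  proof (rule that[OF T.P_homI[OF Q.P.is_group f(1) g compat]])
    show "(case (y_gen m, 0) of (n, h) \<Rightarrow> f n \<otimes>\<^bsub>?Q\<^esub> g h) = (Y_gen m 1, (id, 0))"
      using hom_one[OF g C.is_group Q.P.is_group] a by (simp add: f) (simp add: a_def)
    fix \<sigma> c assume "\<sigma> \<in> carrier (sym_group m)" "c \<in> carrier (integer_mod_group 2)"
    then show "(case (y_perm m \<sigma>, c) of (n, h) \<Rightarrow> f n \<otimes>\<^bsub>?Q\<^esub> g h)
        = (\<one>\<^bsub>?Y\<^esub>, (\<sigma>, (parity \<sigma> + c) mod 2))"
      by (simp add: f q_def g_def Q.mult_P hom_one[OF Q.action_hom Y.is_group Y.is_group]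
          parity_closed sym_group_mult)
  qed
qed

text \<open>The same formula \<open>\<sigma> \<mapsto> \<sigma> \<tau>\<^sup>p\<close> serves in this direction, because twisting twice by the parity
  changes nothing modulo 2. A twisted \<open>s\<^sub>i\<close> with \<open>i \<ge> 2\<close> centralises \<open>a\<close>, and the twisted \<open>s\<^sub>1\<close>
  takes \<open>a\<^sup>k\<close> to \<open>s\<^sub>1 a\<^sup>-\<^sup>k s\<^sub>1\<close>, so that the relation required between \<open>a\<close> and this conjugate is
  the commutator relation of \<open>y(m)\<close>.\<close>

lemma semidirect_to_ytilde:
  obtains G where "G \<in> hom Q.P T.P"
    "\<And>\<sigma>. \<sigma> \<in> carrier (sym_group m) \<Longrightarrow>
      G (Y_gen m (\<sigma> 1), (id, 0)) = conj_by T.P (y_perm m \<sigma>, parity \<sigma>) (y_gen m, 0)"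
    "\<And>\<sigma> c. \<sigma> \<in> carrier (sym_group m) \<Longrightarrow> c \<in> carrier (integer_mod_group 2) \<Longrightarrow>
      G (\<one>\<^bsub>Y_group m\<^esub>, (\<sigma>, c)) = (y_perm m \<sigma>, (parity \<sigma> + c) mod 2)"
proof -
  let ?T = T.P and ?y = "y_group m" and ?a = "y_gen m"
  have inl: "group_hom ?y ?T (\<lambda>n. (n, 0))" using T.inl_group_hom by simp
  define a where "a = (?a, 0 :: int)"
  have a: "a \<in> carrier ?T" by (simp add: a_def T.carrier_P y_gen_closed carrier_C2)
  have mod_closed: "k mod 2 \<in> carrier (integer_mod_group 2)" for k :: int
    by (simp add: carrier_integer_mod_group)
  define g where "g = (\<lambda>(\<sigma>, c). (y_perm m \<sigma>, (parity \<sigma> + c) mod 2))"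
  have g: "g \<in> hom (sym_group m \<times>\<times> integer_mod_group 2) ?T"
  proof (rule homI)
    show "g x \<in> carrier ?T" if "x \<in> carrier (sym_group m \<times>\<times> integer_mod_group 2)" for x
      using that by (auto simp: g_def T.carrier_P mod_closed)
    show "g (x \<otimes>\<^bsub>sym_group m \<times>\<times> integer_mod_group 2\<^esub> x') = g x \<otimes>\<^bsub>?T\<^esub> g x'"
      if xx': "x \<in> carrier (sym_group m \<times>\<times> integer_mod_group 2)"
        "x' \<in> carrier (sym_group m \<times>\<times> integer_mod_group 2)" for x x'
    proof -
      obtain \<sigma> c \<rho> d where x: "x = (\<sigma>, c)" "x' = (\<rho>, d)" by (cases x, cases x')
      have "\<sigma> \<in> carrier (sym_group m)" "\<rho> \<in> carrier (sym_group m)" using x xx' by auto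
      then show ?thesis
        using hom_mult[OF parity_hom, of \<sigma> m \<rho>]
        by (simp add: x g_def T.mult_P tau_action_perm) presburger
    qed
  qed
  define s where "s \<sigma> = (y_perm m \<sigma>, parity \<sigma>)" for \<sigma>
  have s_hom: "s \<in> hom (sym_group m) ?T"
    by (rule homI) (simp_all add: s_def T.carrier_P T.mult_P tau_action_perm parity_closed hom_mult[OF parity_hom])
  have s_closed: "s \<sigma> \<in> carrier ?T" if "\<sigma> \<in> carrier (sym_group m)" for \<sigma>
    using hom_in_carrier[OF s_hom that] .
  have invol: "y_perm m (transpose i j) \<otimes>\<^bsub>?y\<^esub> y_perm m (transpose i j) = \<one>\<^bsub>?y\<^esub>"
    if "transpose i j \<in> carrier (sym_group m)" for i j
    using perm.hom_mult[OF that that] by (simp add: transpose_involution)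
  have conj_s: "conj_by ?T (s \<sigma>) (x, 0) = (conj_by ?y (y_perm m \<sigma>) (tau_action m (parity \<sigma>) x), 0)"
    if "\<sigma> \<in> carrier (sym_group m)" "x \<in> carrier ?y" for \<sigma> x
    using T.conj_by_P[of "y_perm m \<sigma>" "parity \<sigma>" x] that by (simp add: s_def parity_closed)
  have tau: "tau_action m 1 ?a = inv\<^bsub>?y\<^esub> ?a" using tau_action_gen[of 1] by (simp add: carrier_C2)
  have adj: "conj_by ?T (s (transpose i (i + 1))) a = a" if i: "2 \<le> i" "i \<le> m - 1" for i
  proof -
    have t: "transpose i (i + 1) \<in> carrier (sym_group m)"
      by (rule adj_transpose_closed) (use i m in auto)
    interpret c: group_hom ?y ?y "conj_by ?y (y_perm m (transpose i (i + 1)))"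
      using t by (intro y.conj_by_group_hom) simp
    have "conj_by ?y (y_perm m (transpose i (i + 1))) ?a = inv\<^bsub>?y\<^esub> ?a"
      using y_group_inv_relation[OF m i] y.group_conj_involution[OF perm.hom_closed[OF t] invol[OF t]] by simp
    then have "conj_by ?y (y_perm m (transpose i (i + 1))) (inv\<^bsub>?y\<^esub> ?a) = ?a"
      by (simp only: c.hom_inv[OF y_gen_closed] y.inv_inv[OF y_gen_closed])
    then show ?thesis
      using conj_s[OF t y_gen_closed] parity_adj[of i] by (simp add: a_def tau)
  qed
  have rel: "(a [^]\<^bsub>?T\<^esub> k \<otimes>\<^bsub>?T\<^esub> conj_by ?T (s (transpose 1 2)) (a [^]\<^bsub>?T\<^esub> k)) [^]\<^bsub>?T\<^esub> (2::nat) = \<one>\<^bsub>?T\<^esub>"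
    for k :: int
  proof -
    interpret tau: group_hom ?y ?y "tau_action m 1"
      by (rule T.action_group_hom) (simp add: carrier_C2)
    let ?c = "conj_by ?y (y_perm m (transpose 1 2))"
    have yk: "?a [^]\<^bsub>?y\<^esub> j \<in> carrier ?y" for j :: int by (simp add: y_gen_closed)
    have par: "parity (transpose 1 2) = 1" using parity_adj[of 1] by (simp add: numeral_2_eq_2)
    have ak: "a [^]\<^bsub>?T\<^esub> k = (?a [^]\<^bsub>?y\<^esub> k, 0)" by (simp add: a_def y_gen_closed group_hom.hom_int_pow[OF inl])
    have "tau_action m 1 (?a [^]\<^bsub>?y\<^esub> k) = ?a [^]\<^bsub>?y\<^esub> (- k)"
      by (simp add: tau.hom_int_pow tau y_gen_closed y.int_pow_inv y.int_pow_neg)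
    then have conj: "conj_by ?T (s (transpose 1 2)) (a [^]\<^bsub>?T\<^esub> k) = (?c (?a [^]\<^bsub>?y\<^esub> (- k)), 0)"
      using conj_s[OF transpose_12 yk] par by (simp add: ak)
    have "(inv\<^bsub>?y\<^esub> (?a [^]\<^bsub>?y\<^esub> (- k)) \<otimes>\<^bsub>?y\<^esub> ?c (?a [^]\<^bsub>?y\<^esub> (- k))) [^]\<^bsub>?y\<^esub> (2::nat) = \<one>\<^bsub>?y\<^esub>"
      using y.involution_commutes_with_conjugate_iff[OF perm.hom_closed[OF transpose_12] invol[OF transpose_12] yk]
        y_group_comm_relation[OF m] by blast
    then have "(?a [^]\<^bsub>?y\<^esub> k \<otimes>\<^bsub>?y\<^esub> ?c (?a [^]\<^bsub>?y\<^esub> (- k))) [^]\<^bsub>?y\<^esub> (2::nat) = \<one>\<^bsub>?y\<^esub>"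
      by (simp add: y.int_pow_neg y_gen_closed)
    then show ?thesis
      using yk transpose_12 unfolding conj unfolding ak
      by (simp add: T.one_P y.conj_by_closed group_hom.hom_mult[OF inl, symmetric]
          group_hom.hom_nat_pow[OF inl, symmetric])
  qed
  obtain f where f: "f \<in> hom (Y_group m) ?T"
    "\<And>\<sigma>. \<sigma> \<in> carrier (sym_group m) \<Longrightarrow> f (Y_gen m (\<sigma> 1)) = conj_by ?T (s \<sigma>) a"
    using Y_group_universal_conjugates[OF m T.P.is_group s_hom a adj rel] by blast
  interpret f: group_hom "Y_group m" ?T f
    by (intro group_hom.intro group_hom_axioms.intro f) unfold_locales
  have compat: "conj_by ?T (g h) (f x) = f (Y_action m h x)"
    if h: "h \<in> carrier (sym_group m \<times>\<times> integer_mod_group 2)" and x: "x \<in> carrier (Y_group m)" for h x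
  proof (rule Y_group_hom_eqI[OF T.P.is_group _ _ _ x, where h = "\<lambda>x. conj_by ?T (g h) (f x)"])
    obtain \<sigma> c where h': "h = (\<sigma>, c)" "\<sigma> \<in> carrier (sym_group m)" "c \<in> carrier (integer_mod_group 2)"
      using h by auto
    have gh: "g h \<in> carrier ?T" using hom_in_carrier[OF g h] .
    show "(\<lambda>x. conj_by ?T (g h) (f x)) \<in> hom (Y_group m) ?T"
      using Group.hom_compose[OF f(1) T.P.conj_by_hom[OF gh]] by (simp add: o_def)
    show "(\<lambda>x. f (Y_action m h x)) \<in> hom (Y_group m) ?T"
      using Group.hom_compose[OF Q.action_hom[OF h] f(1)] by (simp add: o_def)
    fix i assume i: "i \<in> {1..m}"
    define \<rho> where "\<rho> = transpose 1 i"
    have \<rho>: "\<rho> \<in> carrier (sym_group m)" "\<rho> 1 = i"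
      using i m by (auto simp: \<rho>_def sym_group_carrier intro!: permutes_swap_id)
    define \<pi> where "\<pi> = \<sigma> \<otimes>\<^bsub>sym_group m\<^esub> \<rho>"
    have \<pi>: "\<pi> \<in> carrier (sym_group m)" "\<pi> 1 = \<sigma> i"
      using \<rho> h' by (simp_all add: \<pi>_def) (simp add: sym_group_mult)
    interpret c: group_hom ?T ?T "conj_by ?T (s \<pi>)" using \<pi> by (intro T.P.conj_by_group_hom s_closed)
    have t: "(\<one>\<^bsub>?y\<^esub>, c) \<in> carrier ?T" using h' by (simp add: T.carrier_P)
    \<comment> \<open>Moving \<open>\<tau>\<^sup>c\<close> to the right past the twisted permutation leaves it next to \<open>a\<close>, which it fixes or inverts.\<close>
    have "g h \<otimes>\<^bsub>?T\<^esub> s \<rho> = s \<pi> \<otimes>\<^bsub>?T\<^esub> (\<one>\<^bsub>?y\<^esub>, c)"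
      using \<rho> h' hom_mult[OF parity_hom, of \<sigma> m \<rho>]
      by (simp add: g_def s_def \<pi>_def T.mult_P tau_action_perm parity_closed mod_closed
          hom_one[OF T.action_hom y.is_group y.is_group] mod_simps algebra_simps)
    then have "conj_by ?T (g h) (conj_by ?T (s \<rho>) a) = conj_by ?T (s \<pi>) (conj_by ?T (\<one>\<^bsub>?y\<^esub>, c) a)"
      using gh a \<rho> \<pi> t by (simp add: s_closed flip: T.P.conj_by_mult)
    also have "conj_by ?T (\<one>\<^bsub>?y\<^esub>, c) a = (if c = 0 then a else inv\<^bsub>?T\<^esub> a)"
      using T.conj_by_inr[of ?a c] h' group_hom.hom_inv[OF inl y_gen_closed] by (simp add: a_def y_gen_closed tau_action_gen)
    finally have "conj_by ?T (g h) (f (Y_gen m i)) =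
        (if c = 0 then f (Y_gen m (\<sigma> i)) else inv\<^bsub>?T\<^esub> (f (Y_gen m (\<sigma> i))))"
      using f(2)[OF \<rho>(1)] f(2)[OF \<pi>(1)] a \<rho> \<pi> by (simp del: One_nat_def)
    moreover have "\<sigma> i \<in> {1..m}" using h' i permutes_in_image by (metis sym_group_carrier)
    ultimately show "conj_by ?T (g h) (f (Y_gen m i)) = f (Y_action m h (Y_gen m i))"
      using h' i Y_action_gen by (simp add: Y_gen_closed del: atLeastAtMost_iff)
  qed
  show ?thesis
  proof (rule that[OF Q.P_homI[OF T.P.is_group f(1) g compat]])
    fix \<sigma> assume \<sigma>: "\<sigma> \<in> carrier (sym_group m)"
    have "g (id, 0) = \<one>\<^bsub>?T\<^esub>"
      using hom_one[OF g Q.H.is_group T.P.is_group] by (simp add: sym_group_one)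
    then show "(case (Y_gen m (\<sigma> 1), (id, 0)) of (n, h) \<Rightarrow> f n \<otimes>\<^bsub>?T\<^esub> g h)
        = conj_by ?T (y_perm m \<sigma>, parity \<sigma>) (y_gen m, 0)"
      using f(2)[OF \<sigma>] T.P.conj_by_closed[OF s_closed[OF \<sigma>] a] by (simp add: s_def a_def del: One_nat_def)
    fix c assume "c \<in> carrier (integer_mod_group 2)"
    then have "g (\<sigma>, c) \<in> carrier ?T" using hom_in_carrier[OF g, of "(\<sigma>, c)"] \<sigma> by simp
    then show "(case (\<one>\<^bsub>Y_group m\<^esub>, (\<sigma>, c)) of (n, h) \<Rightarrow> f n \<otimes>\<^bsub>?T\<^esub> g h)
        = (y_perm m \<sigma>, (parity \<sigma> + c) mod 2)"
      by simp (simp add: g_def)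
  qed
qed

lemma ytilde_iso_semidirect: "T.P \<cong> Q.P"
proof -
  have id: "id \<in> carrier (sym_group m)" "y_perm m id = \<one>\<^bsub>y_group m\<^esub>" "parity id = 0"
    using S.one_closed perm.hom_one by (simp_all add: sym_group_one parity_def)
  obtain F where F: "F \<in> hom T.P Q.P" "F (y_gen m, 0) = (Y_gen m 1, (id, 0))"
    and F_perm: "\<And>\<sigma> c. \<sigma> \<in> carrier (sym_group m) \<Longrightarrow> c \<in> carrier (integer_mod_group 2) \<Longrightarrow>
      F (y_perm m \<sigma>, c) = (\<one>\<^bsub>Y_group m\<^esub>, (\<sigma>, (parity \<sigma> + c) mod 2))"
    using ytilde_to_semidirect by blast
  obtain G where G: "G \<in> hom Q.P T.P"
    and G_gen: "\<And>\<sigma>. \<sigma> \<in> carrier (sym_group m) \<Longrightarrow>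
      G (Y_gen m (\<sigma> 1), (id, 0)) = conj_by T.P (y_perm m \<sigma>, parity \<sigma>) (y_gen m, 0)"
    and G_perm: "\<And>\<sigma> c. \<sigma> \<in> carrier (sym_group m) \<Longrightarrow> c \<in> carrier (integer_mod_group 2) \<Longrightarrow>
      G (\<one>\<^bsub>Y_group m\<^esub>, (\<sigma>, c)) = (y_perm m \<sigma>, (parity \<sigma> + c) mod 2)"
    using semidirect_to_ytilde by blast
  interpret F: group_hom T.P Q.P F by (intro group_hom.intro group_hom_axioms.intro F) unfold_locales
  interpret G: group_hom Q.P T.P G by (intro group_hom.intro group_hom_axioms.intro G) unfold_locales
  have GF: "(\<lambda>x. G (F x)) \<in> hom T.P T.P" and FG: "(\<lambda>x. F (G x)) \<in> hom Q.P Q.P"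
    using Group.hom_compose[OF F(1) G] Group.hom_compose[OF G F(1)] by (simp_all add: o_def)
  have id_hom: "(\<lambda>x. x) \<in> hom K K" for K :: "('x, 'y) monoid_scheme" by (simp add: hom_def)
  have twice: "(k + (k + c) mod 2) mod 2 = c" if "c \<in> carrier (integer_mod_group 2)" for k c :: int
    using that by (auto simp: carrier_C2) presburger
  have mod_closed: "k mod 2 \<in> carrier (integer_mod_group 2)" for k :: int
    by (simp add: carrier_integer_mod_group)
  have one_S: "\<one>\<^bsub>sym_group m \<times>\<times> integer_mod_group 2\<^esub> = (id, 0)" by (simp add: sym_group_one)
  have gen: "(y_gen m, 0) \<in> carrier T.P" by (simp add: T.carrier_P y_gen_closed)
  have "G (F x) = x" if x: "x \<in> carrier T.P" for x
  proof (rule T.P_hom_eqI[OF GF id_hom _ _ x])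
    show "G (F (n, \<one>\<^bsub>integer_mod_group 2\<^esub>)) = (n, \<one>\<^bsub>integer_mod_group 2\<^esub>)"
      if n: "n \<in> carrier (y_group m)" for n
    proof (rule y_group_hom_eqI[OF m T.P.is_group Group.hom_compose[OF T.inl_hom GF, unfolded o_def]
          T.inl_hom _ _ n])
      have "G (F (y_gen m, 0)) = (y_gen m, 0)"
        using G_gen[OF id(1)] id gen by (simp add: F T.P.conj_by_one T.one_P[symmetric, simplified])
      then show "G (F (y_gen m, \<one>\<^bsub>integer_mod_group 2\<^esub>)) = (y_gen m, \<one>\<^bsub>integer_mod_group 2\<^esub>)" by simp
      fix \<sigma> assume "\<sigma> \<in> carrier (sym_group m)"
      then show "G (F (y_perm m \<sigma>, \<one>\<^bsub>integer_mod_group 2\<^esub>)) = (y_perm m \<sigma>, \<one>\<^bsub>integer_mod_group 2\<^esub>)"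
        using mod_closed[of 0] by (simp add: F_perm G_perm mod_closed)
    qed
    fix c assume c: "c \<in> carrier (integer_mod_group 2)"
    then show "G (F (\<one>\<^bsub>y_group m\<^esub>, c)) = (\<one>\<^bsub>y_group m\<^esub>, c)"
      using F_perm[OF id(1) c] G_perm[OF id(1) c] twice[OF c, of 0] id by simp
  qed
  moreover have "F (G x) = x" if x: "x \<in> carrier Q.P" for x
  proof (rule Q.P_hom_eqI[OF FG id_hom _ _ x])
    fix n assume n: "n \<in> carrier (Y_group m)"
    show "F (G (n, \<one>\<^bsub>sym_group m \<times>\<times> integer_mod_group 2\<^esub>)) = (n, \<one>\<^bsub>sym_group m \<times>\<times> integer_mod_group 2\<^esub>)"
    proof (rule Y_group_hom_eqI[OF Q.P.is_group Group.hom_compose[OF Q.inl_hom FG, unfolded o_def]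
          Q.inl_hom _ n])
      fix i assume i: "i \<in> {1..m}"
      define \<rho> where "\<rho> = transpose 1 i"
      have \<rho>: "\<rho> \<in> carrier (sym_group m)" "\<rho> 1 = i"
        using i m by (auto simp: \<rho>_def sym_group_carrier intro!: permutes_swap_id)
      have "(y_perm m \<rho>, parity \<rho>) \<in> carrier T.P" using \<rho> by (simp add: T.carrier_P parity_closed)
      then have "F (G (Y_gen m i, (id, 0))) =
          conj_by Q.P (F (y_perm m \<rho>, parity \<rho>)) (Y_gen m 1, (id, 0))"
        using G_gen[OF \<rho>(1)] \<rho>(2) gen F by (simp add: F.hom_conj_by)
      also have "F (y_perm m \<rho>, parity \<rho>) = (\<one>\<^bsub>Y_group m\<^esub>, (\<rho>, 0))"
        using F_perm[OF \<rho>(1) parity_closed] by simp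
      also have "conj_by Q.P (\<one>\<^bsub>Y_group m\<^esub>, (\<rho>, 0)) (Y_gen m 1, (id, 0)) = (Y_gen m i, (id, 0))"
        using Q.conj_by_inr[of "Y_gen m 1" "(\<rho>, 0)"] Y_gen_closed[of 1 m] m \<rho> Y_action_gen[OF \<rho>(1), of 1 0]
        by (simp add: sym_group_one carrier_C2)
      finally show "F (G (Y_gen m i, \<one>\<^bsub>sym_group m \<times>\<times> integer_mod_group 2\<^esub>)) =
          (Y_gen m i, \<one>\<^bsub>sym_group m \<times>\<times> integer_mod_group 2\<^esub>)" unfolding one_S .
    qed
  next
    fix h assume "h \<in> carrier (sym_group m \<times>\<times> integer_mod_group 2)"
    then show "F (G (\<one>\<^bsub>Y_group m\<^esub>, h)) = (\<one>\<^bsub>Y_group m\<^esub>, h)"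
      by (auto simp: F_perm G_perm mod_closed twice)
  qed
  ultimately have "bij_betw F (carrier T.P) (carrier Q.P)"
    by (intro bij_betwI[where g = G]) auto
  then show ?thesis using F by (intro is_isoI[where h = F] isoI)
qed

end

theorem proposition2p5:
  fixes m :: nat
  assumes "m \<ge> 2"
  shows "ytilde_group m \<cong>
    semidirect_product (Y_group m) (sym_group m \<times>\<times> integer_mod_group 2) (Y_action m)"
  unfolding ytilde_group_def by (rule ytilde_iso_semidirect[OF assms])

end
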